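(* Let $L$ be a noneuclidean projective line in $\mathbb P_{\mathbb K}V$ spanned by distinct, nonisotropic, and nonorthogonal points $p,q\in\mathbb P_{\mathbb K}V$ of the same signature (i.e. $\langle p,p\rangle$ and $\langle q,q\rangle$ have the same sign). Let $t=h+v$, with $h\in T_pL$ and $v\in(T_pL)^\perp$, be the horizontal-vertical decomposition of $t\in T_p\mathbb P_{\mathbb K}V$ with respect to $L$. Then the parallel transport (for the Levi-Civita connection of the metric) of $t$ from $p$ to $q$ along $G[p,q]$ is given by $\mathrm{Tn}(h)(q)+\mathrm{Ct}(v)(q)$.
   Context: $\mathbb K$ is $\mathbb R$, $\mathbb C$ or $\mathbb H$ (quaternions). $V$ is a finite-dimensional right $\mathbb K$-vector space with a nondegenerate hermitian form $\langle-,-\rangle$: it takes values in $\mathbb K$, is biadditive, and satisfies $\langle v_1k,v_2\rangle=\overline k\langle v_1,v_2\rangle$, $\langle v_1,v_2k\rangle=\langle v_1,v_2\rangle k$, $\langle v_1,v_2\rangle=\overline{\langle v_2,v_1\rangle}$. A point of $\mathbb P_{\mathbb K}V$, a representative in $V$, and the corresponding one-dimensional subspace are denoted by the same letter. A point $p$ is isotropic if $\langle p,p\rangle=0$; $SV$ is the set of isotropic points. Points $p,q$ are orthogonal if $\langle p,q\rangle=0$. For $p$ nonisotropic, $\pi'[p]v:=p\frac{\langle p,v\rangle}{\langle p,p\rangle}$ and $\pi[p]v:=v-\pi'[p]v$ are the orthogonal projections onto $p$ and $p^\perp$, and $T_p\mathbb P_{\mathbb K}V=\mathrm{Lin}_{\mathbb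 K}(p,p^\perp)$, where $\varphi:p\to p^\perp$ corresponds to the derivation $f\mapsto\frac{d}{d\varepsilon}|_{\varepsilon=0}\hat f(p+\varepsilon\varphi p)$, $\hat f$ being the lift of $f$ to $V\setminus\{0\}$. Extending by zero on $p^\perp$, tangent vectors at $p$ are regarded as elements of $\mathrm{Lin}_{\mathbb K}(V,V)$. The metric is $(t_1,t_2):=\pm\frac{\mathrm{tr}_{\mathbb R}(t_1^*t_2)}{\dim_{\mathbb R}\mathbb K}$ for $t_1,t_2\in T_p\mathbb P_{\mathbb K}V$ (one of the signs being fixed), where $t_1^*$ is the adjoint with respect to $\langle-,-\rangle$; it is a pseudo-riemannian metric on $\mathbb P_{\mathbb K}V\setminus SV$, and orthogonal complements in $T_p\mathbb P_{\mathbb K}V$ are taken with respect to it. A projective line is the projectivization of a 2-dimensional $\mathbb K$-subspace; it is euclidean if the form on this subspace is nonnull and degenerate. If $L$ is noneuclidean and $p\in L$ is nonisotropic, then $T_p\mathbb P_{\mathbb K}V=T_pL\oplus(T_pL)^\perp$, which gives the horizontal-vertical decomposition. A geodesic is a circle $\mathbb P_{\mathbb K}W\subset\mathbb P_{\mathbb K}V$ (the image of $W\setminus\{0\}$), where $W\subset V$ is a 2-dimensional real subspace on which the hermitian form is real-valued and not identically zero. Two distinct nonorthogonal points $p,q$ lie on a unique geodesic; for $p$ nonisotropic, $G[p,q]$ is the oriented segment of this geodesic from $p$ to $q$ that does not contain the point orthogonal to $p$ (the unique point of the projective line spanned by $p,q$ that is orthogonal to $p$). For $t\in\mathrm{Lin}_{\mathbb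 K}(V,V)$ and $x$ nonisotropic put $t_x:=\pi[x]\,t\,\pi'[x]\in T_x\mathbb P_{\mathbb K}V$; the field $T(x)=t_x$ is said to be spread from $t$. Put $\mathrm{ta}(p,x):=\frac{\langle p,x\rangle\langle x,p\rangle}{\langle p,p\rangle\langle x,x\rangle}$. For a tangent vector $t$ at $p$, with $T$ spread from $t$, set $\mathrm{Tn}(t)(x):=\frac{T(x)}{\mathrm{ta}(p,x)}$ and $\mathrm{Ct}(t)(x):=\frac{T(x)}{\sqrt{\mathrm{ta}(p,x)}}$ (the latter for $x$ nonorthogonal to $p$ in the component of $\mathbb P_{\mathbb K}V\setminus SV$ containing $p$). *)

theory Defs
  imports "HOL-Analysis.Analysis"
begin

section \<open>Quaternions\<close>

datatype quat = Quat (qre: real) (qi: real) (qj: real) (qk: real)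

lemma quat_eq_iff: "x = y \<longleftrightarrow> qre x = qre y \<and> qi x = qi y \<and> qj x = qj y \<and> qk x = qk y"
  by (cases x; cases y) auto

instantiation quat :: ring_1
begin

definition "0 = Quat 0 0 0 0"
definition "1 = Quat 1 0 0 0"
definition "x + y = Quat (qre x + qre y) (qi x + qi y) (qj x + qj y) (qk x + qk y)"
definition "x - y = Quat (qre x - qre y) (qi x - qi y) (qj x - qj y) (qk x - qk y)"
definition "- x = Quat (- qre x) (- qi x) (- qj x) (- qk x)"
definition "x * y = Quat
  (qre x * qre y - qi x * qi y - qj x * qj y - qk x * qk y)
  (qre x * qi y + qi x * qre y + qj x * qk y - qk x * qj y)
  (qre x * qj y - qi x * qk y + qj x * qre y + qk x * qi y)
  (qre x * qk y + qi x * qj y - qj x * qi y + qk x * qre y)"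

instance
proof
  fix x y z :: quat
  show "x * y * z = x * (y * z)" "(x + y) * z = x * z + y * z" "x * (y + z) = x * y + x * z"
    unfolding times_quat_def plus_quat_def quat.sel quat.inject by algebra+
qed (simp_all add: zero_quat_def one_quat_def plus_quat_def minus_quat_def uminus_quat_def
      times_quat_def)

end

instantiation quat :: real_vector
begin

definition "r *\<^sub>R x = Quat (r * qre x) (r * qi x) (r * qj x) (r * qk x)"

instance
  by standard (auto simp: scaleR_quat_def plus_quat_def algebra_simps)

end

instantiation quat :: real_inner
begin

definition "x \<bullet> y = qre x * qre y + qi x * qi y + qj x * qj y + qk x * qk y"
definition norm_quat where "norm (x::quat) = sqrt (x \<bullet> x)"
definition sgn_quat where "sgn (x::quat) = x /\<^sub>R norm x"
definition dist_quat where "dist (x::quat) y = norm (x - y)"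
definition uniformity_quat where
  "(uniformity :: (quat \<times> quat) filter) = (INF e\<in>{0<..}. principal {(x, y). dist x y < e})"
definition open_quat where
  "open (U :: quat set) \<longleftrightarrow>
    (\<forall>x\<in>U. eventually (\<lambda>(x', y). x' = x \<longrightarrow> y \<in> U) uniformity)"

instance
proof
  fix x y z :: quat and r :: real
  show "dist x y = norm (x - y)" "sgn x = x /\<^sub>R norm x" "norm x = sqrt (x \<bullet> x)"
    by (simp_all add: dist_quat_def sgn_quat_def norm_quat_def)
  show "(uniformity :: (quat \<times> quat) filter)
      = (INF e\<in>{0<..}. principal {(x, y). dist x y < e})"
    by (rule uniformity_quat_def)
  show "open U \<longleftrightarrow> (\<forall>x\<in>U. eventually (\<lambda>(x', y). x' = x \<longrightarrow> y \<in> U) uniformity)" for U :: "quat set"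
    by (rule open_quat_def)
  show "x \<bullet> y = y \<bullet> x" "(x + y) \<bullet> z = x \<bullet> z + y \<bullet> z" "(r *\<^sub>R x) \<bullet> y = r * (x \<bullet> y)"
    "0 \<le> x \<bullet> x"
    by (simp_all add: inner_quat_def plus_quat_def scaleR_quat_def algebra_simps)
  show "x \<bullet> x = 0 \<longleftrightarrow> x = 0"
    by (simp add: inner_quat_def zero_quat_def quat_eq_iff add_nonneg_eq_0_iff)
qed

end

instantiation quat :: euclidean_space
begin

definition "Basis = {Quat 1 0 0 0, Quat 0 1 0 0, Quat 0 0 1 0, Quat 0 0 0 1}"

instance
proof
  fix u v x :: quat
  show "(Basis :: quat set) \<noteq> {}" "finite (Basis :: quat set)"
    by (simp_all add: Basis_quat_def)
  show "u \<bullet> v = (if u = v then 1 else 0)" if "u \<in> Basis" "v \<in> Basis"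
    using that unfolding Basis_quat_def inner_quat_def by (elim insertE emptyE; simp)
  show "(\<forall>u\<in>Basis. x \<bullet> u = 0) \<longleftrightarrow> x = 0"
    by (cases x) (simp add: Basis_quat_def inner_quat_def zero_quat_def)
qed

end

instantiation quat :: real_normed_div_algebra
begin

definition "inverse x = Quat (qre x) (- qi x) (- qj x) (- qk x) /\<^sub>R (x \<bullet> x)"
definition "x div y = x * inverse (y::quat)"

instance
proof
  fix x y :: quat and r :: real
  show scaleR: "(r *\<^sub>R x) * y = r *\<^sub>R (x * y)" "x * (r *\<^sub>R y) = r *\<^sub>R (x * y)" for r and x y :: quat
    by (simp_all add: scaleR_quat_def times_quat_def algebra_simps)
  have "(x * y) \<bullet> (x * y) = (x \<bullet> x) * (y \<bullet> y)"
    unfolding inner_quat_def times_quat_def quat.sel by algebra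
  then show "norm (x * y) = norm x * norm y"
    by (simp add: norm_quat_def real_sqrt_mult)
  show "inverse 0 = (0::quat)"
    by (simp add: inverse_quat_def zero_quat_def scaleR_quat_def)
  show "x div y = x * inverse y"
    by (rule divide_quat_def)
  define c where "c = Quat (qre x) (- qi x) (- qj x) (- qk x)"
  have c: "c * x = (x \<bullet> x) *\<^sub>R 1" "x * c = (x \<bullet> x) *\<^sub>R 1"
    by (simp_all add: c_def inner_quat_def times_quat_def scaleR_quat_def one_quat_def)
  assume "x \<noteq> 0"
  then have "x \<bullet> x \<noteq> 0" by simp
  then show "inverse x * x = 1" "x * inverse x = 1"
    by (simp_all only: inverse_quat_def c_def[symmetric] scaleR c) simp_all
qed

end


section \<open>The scalars\<close>

text \<open>By Frobenius' theorem the instances of this class are, up to isomorphism, exactly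
  \<open>\<real>\<close>, \<open>\<complex>\<close> and the quaternions, and the axioms determine \<open>conj\<close>: it is the standard conjugation,
  since \<open>conj x = (norm x)\<^sup>2 / x\<close>.\<close>

class rch = real_normed_div_algebra + euclidean_space +
  fixes conj :: "'a \<Rightarrow> 'a"
  assumes conj_add: "conj (x + y) = conj x + conj y"
    and conj_mult: "conj (x * y) = conj y * conj x"
    and conj_conj: "conj (conj x) = x"
    and conj_times_self: "conj x * x = (norm x)\<^sup>2 *\<^sub>R 1"

instantiation real :: rch
begin
definition "conj x = (x::real)"
instance by standard (auto simp: conj_real_def power2_eq_square)
end

instantiation complex :: rch
begin
definition "conj x = cnj x"
instance
proof
  fix x y :: complex
  show "conj (x + y) = conj x + conj y" "conj (x * y) = conj y * conj x" "conj (conj x) = x"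
    by (simp_all add: conj_complex_def)
  show "conj x * x = (norm x)\<^sup>2 *\<^sub>R 1"
    using complex_norm_square[of x] by (simp add: conj_complex_def scaleR_conv_of_real mult.commute)
qed
end

instantiation quat :: rch
begin
definition "conj x = Quat (qre x) (- qi x) (- qj x) (- qk x)"
instance
proof
  fix x y :: quat
  show "conj (x + y) = conj x + conj y" "conj (x * y) = conj y * conj x" "conj (conj x) = x"
    by (simp_all add: conj_quat_def plus_quat_def times_quat_def algebra_simps)
  show "conj x * x = (norm x)\<^sup>2 *\<^sub>R 1"
    by (simp add: conj_quat_def norm_quat_def inner_quat_def times_quat_def
        scaleR_quat_def one_quat_def power2_eq_square algebra_simps)
qed
end

text \<open>The real part: \<open>conj x + x = 2 * of_real (re x)\<close>.\<close>

definition re :: "'k::rch \<Rightarrow> real" where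
  "re x = x \<bullet> 1"

lemma re_real: "re (x::real) = x" and re_complex: "re (z::complex) = Re z"
  and re_quat: "re (q::quat) = qre q"
  by (simp_all add: re_def inner_complex_def inner_quat_def one_quat_def)


section \<open>Hermitian spaces\<close>

record ('k, 'v) hspace =
  smul :: "'v \<Rightarrow> 'k \<Rightarrow> 'v"  (infixl "\<cdot>\<index>" 75)
  herm :: "'v \<Rightarrow> 'v \<Rightarrow> 'k"  ("\<langle>_,_\<rangle>\<index>")

text \<open>The type \<open>'v\<close> provides the underlying finite-dimensional real vector space with its usual
  topology. Its inner product is auxiliary: it enters below only through the topology and in a
  basis-independent real trace.\<close>

locale hermitian_space =
  fixes V :: "('k::rch, 'v::euclidean_space) hspace" (structure)
  assumes smul_add_left: "(v + w) \<cdot> k = v \<cdot> k + w \<cdot> k"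
    and smul_add_right: "v \<cdot> (k + l) = v \<cdot> k + v \<cdot> l"
    and smul_smul: "v \<cdot> (k * l) = (v \<cdot> k) \<cdot> l"
    and smul_of_real: "v \<cdot> of_real r = r *\<^sub>R v"
    and herm_add_left: "\<langle>v + v', w\<rangle> = \<langle>v, w\<rangle> + \<langle>v', w\<rangle>"
    and herm_add_right: "\<langle>v, w + w'\<rangle> = \<langle>v, w\<rangle> + \<langle>v, w'\<rangle>"
    and herm_smul_left: "\<langle>v \<cdot> k, w\<rangle> = conj k * \<langle>v, w\<rangle>"
    and herm_smul_right: "\<langle>v, w \<cdot> k\<rangle> = \<langle>v, w\<rangle> * k"
    and herm_conj: "\<langle>v, w\<rangle> = conj \<langle>w, v\<rangle>"
    and herm_nondegenerate: "(\<And>w. \<langle>v, w\<rangle> = 0) \<Longrightarrow> v = 0"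


section \<open>Smooth maps\<close>

fun Ck_on :: "nat \<Rightarrow> 'a::euclidean_space set \<Rightarrow> ('a \<Rightarrow> 'b::real_normed_vector) \<Rightarrow> bool" where
  "Ck_on 0 U f \<longleftrightarrow> continuous_on U f"
| "Ck_on (Suc n) U f \<longleftrightarrow> (\<forall>x\<in>U. f differentiable at x) \<and>
     (\<forall>v. Ck_on n U (\<lambda>x. frechet_derivative f (at x) v))"

text \<open>\<open>Ck_on\<close> is meant for open sets; on an arbitrary set, a smooth map is one that extends
  smoothly to an open neighbourhood.\<close>

definition smooth_on :: "'a::euclidean_space set \<Rightarrow> ('a \<Rightarrow> 'b::real_normed_vector) \<Rightarrow> bool" where
  "smooth_on S f \<longleftrightarrow> (\<exists>U g. open U \<and> S \<subseteq> U \<and> (\<forall>n. Ck_on n U g) \<and> (\<forall>x\<in>S. g x = f x))"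


section \<open>Projective space and its tangent vectors\<close>

text \<open>A point of the projective space is a one-dimensional subspace \<open>line V p\<close>, \<open>p \<noteq> 0\<close>. The lift
  of a function \<open>f\<close> on points to \<open>V \ {0}\<close> is \<open>\<lambda>x. f (line V x)\<close>.\<close>

definition line :: "('k::rch, 'v::euclidean_space) hspace \<Rightarrow> 'v \<Rightarrow> 'v set" where
  "line V p = range (\<lambda>k. p \<cdot>\<^bsub>V\<^esub> k)"

definition rep :: "'v::euclidean_space set \<Rightarrow> 'v" where
  "rep P = (SOME v. v \<in> P \<and> v \<noteq> 0)"

definition nonisotropic :: "('k::rch, 'v::euclidean_space) hspace \<Rightarrow> 'v \<Rightarrow> bool" where
  "nonisotropic V p \<longleftrightarrow> \<langle>p,p\<rangle>\<^bsub>V\<^esub> \<noteq> 0"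

definition nonisotropic_points :: "('k::rch, 'v::euclidean_space) hspace \<Rightarrow> 'v set set" where
  "nonisotropic_points V = line V ` {p. nonisotropic V p}"

definition perp :: "('k::rch, 'v::euclidean_space) hspace \<Rightarrow> 'v set \<Rightarrow> 'v set" where
  "perp V P = {v. \<forall>p\<in>P. \<langle>p,v\<rangle>\<^bsub>V\<^esub> = 0}"

definition klinear :: "('k::rch, 'v::euclidean_space) hspace \<Rightarrow> ('v \<Rightarrow>\<^sub>L 'v) \<Rightarrow> bool" where
  "klinear V t \<longleftrightarrow> (\<forall>v k. t (v \<cdot>\<^bsub>V\<^esub> k) = t v \<cdot>\<^bsub>V\<^esub> k)"

definition proj' :: "('k::rch, 'v::euclidean_space) hspace \<Rightarrow> 'v \<Rightarrow> 'v \<Rightarrow> 'v" where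
  "proj' V p v = p \<cdot>\<^bsub>V\<^esub> (\<langle>p,v\<rangle>\<^bsub>V\<^esub> / \<langle>p,p\<rangle>\<^bsub>V\<^esub>)"

definition proj :: "('k::rch, 'v::euclidean_space) hspace \<Rightarrow> 'v \<Rightarrow> 'v \<Rightarrow> 'v" where
  "proj V p v = v - proj' V p v"

text \<open>\<open>Lin(P, P\<^sup>\<bottom>)\<close>, extended by zero on \<open>P\<^sup>\<bottom>\<close>; used for nonisotropic points only.\<close>

definition tangent_space ::
  "('k::rch, 'v::euclidean_space) hspace \<Rightarrow> 'v set \<Rightarrow> ('v \<Rightarrow>\<^sub>L 'v) set" where
  "tangent_space V P = {t. klinear V t \<and> (\<forall>v\<in>P. t v \<in> perp V P) \<and> (\<forall>v\<in>perp V P. t v = 0)}"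

text \<open>The derivation given by a tangent vector \<open>t\<close> at \<open>P\<close>; it does not depend on the
  representative of \<open>P\<close>.\<close>

definition derivation :: "('k::rch, 'v::euclidean_space) hspace \<Rightarrow> 'v set \<Rightarrow> ('v \<Rightarrow>\<^sub>L 'v)
    \<Rightarrow> ('v set \<Rightarrow> real) \<Rightarrow> real" where
  "derivation V P t f = deriv (\<lambda>\<epsilon>. f (line V (rep P + \<epsilon> *\<^sub>R t (rep P)))) 0"


section \<open>The metric\<close>

definition adjoint' :: "('k::rch, 'v::euclidean_space) hspace \<Rightarrow> ('v \<Rightarrow>\<^sub>L 'v) \<Rightarrow> ('v \<Rightarrow>\<^sub>L 'v)" where
  "adjoint' V t = (THE s :: 'v \<Rightarrow>\<^sub>L 'v. \<forall>v w. \<langle>t v, w\<rangle>\<^bsub>V\<^esub> = \<langle>v, s w\<rangle>\<^bsub>V\<^esub>)"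

definition real_trace :: "('v::euclidean_space \<Rightarrow>\<^sub>L 'v) \<Rightarrow> real" where
  "real_trace t = (\<Sum>b\<in>Basis. t b \<bullet> b)"

text \<open>\<open>\<sigma>\<close> is the sign chosen for the metric.\<close>

definition metric :: "('k::rch, 'v::euclidean_space) hspace \<Rightarrow> real
    \<Rightarrow> ('v \<Rightarrow>\<^sub>L 'v) \<Rightarrow> ('v \<Rightarrow>\<^sub>L 'v) \<Rightarrow> real" where
  "metric V \<sigma> t\<^sub>1 t\<^sub>2 = \<sigma> * (real_trace (adjoint' V t\<^sub>1 o\<^sub>L t\<^sub>2) / DIM('k))"


section \<open>The Levi-Civita connection\<close>

definition smooth_function ::
  "('k::rch, 'v::euclidean_space) hspace \<Rightarrow> ('v set \<Rightarrow> real) \<Rightarrow> bool" where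
  "smooth_function V f \<longleftrightarrow> smooth_on {x. nonisotropic V x} (\<lambda>x. f (line V x))"

definition smooth_field ::
  "('k::rch, 'v::euclidean_space) hspace \<Rightarrow> ('v set \<Rightarrow> ('v \<Rightarrow>\<^sub>L 'v)) \<Rightarrow> bool" where
  "smooth_field V X \<longleftrightarrow> (\<forall>P\<in>nonisotropic_points V. X P \<in> tangent_space V P) \<and>
     smooth_on {x. nonisotropic V x} (\<lambda>x. X (line V x))"

text \<open>A connection on the nonisotropic points: \<open>\<nabla> P t Y\<close> is the covariant derivative of the vector
  field \<open>Y\<close> along the tangent vector \<open>t\<close> at \<open>P\<close>.\<close>

locale connection =
  fixes V :: "('k::rch, 'v::euclidean_space) hspace"
    and nabla :: "'v set \<Rightarrow> ('v \<Rightarrow>\<^sub>L 'v) \<Rightarrow> ('v set \<Rightarrow> ('v \<Rightarrow>\<^sub>L 'v)) \<Rightarrow> ('v \<Rightarrow>\<^sub>L 'v)" ("\<nabla>")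
  assumes tangent: "\<lbrakk>P \<in> nonisotropic_points V; t \<in> tangent_space V P; smooth_field V Y\<rbrakk>
      \<Longrightarrow> \<nabla> P t Y \<in> tangent_space V P"
    and linear_left: "\<lbrakk>P \<in> nonisotropic_points V; t \<in> tangent_space V P; u \<in> tangent_space V P;
        smooth_field V Y\<rbrakk>
      \<Longrightarrow> \<nabla> P (r *\<^sub>R t + s *\<^sub>R u) Y = r *\<^sub>R \<nabla> P t Y + s *\<^sub>R \<nabla> P u Y"
    and add_right: "\<lbrakk>P \<in> nonisotropic_points V; t \<in> tangent_space V P; smooth_field V Y;
        smooth_field V Z\<rbrakk>
      \<Longrightarrow> \<nabla> P t (\<lambda>Q. Y Q + Z Q) = \<nabla> P t Y + \<nabla> P t Z"
    and leibniz: "\<lbrakk>P \<in> nonisotropic_points V; t \<in> tangent_space V P; smooth_field V Y;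
        smooth_function V f\<rbrakk>
      \<Longrightarrow> \<nabla> P t (\<lambda>Q. f Q *\<^sub>R Y Q) = derivation V P t f *\<^sub>R Y P + f P *\<^sub>R \<nabla> P t Y"
    and smooth: "\<lbrakk>smooth_field V X; smooth_field V Y\<rbrakk> \<Longrightarrow> smooth_field V (\<lambda>P. \<nabla> P (X P) Y)"

text \<open>The left-hand side of \<open>torsion_free\<close> is the bracket of \<open>X\<close> and \<open>Y\<close> applied to \<open>f\<close>.\<close>

locale levi_civita = connection V nabla
  for V :: "('k::rch, 'v::euclidean_space) hspace" and \<sigma> :: real
    and nabla :: "'v set \<Rightarrow> ('v \<Rightarrow>\<^sub>L 'v) \<Rightarrow> ('v set \<Rightarrow> ('v \<Rightarrow>\<^sub>L 'v)) \<Rightarrow> ('v \<Rightarrow>\<^sub>L 'v)" ("\<nabla>") +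
  assumes torsion_free: "\<lbrakk>P \<in> nonisotropic_points V; smooth_field V X; smooth_field V Y;
        smooth_function V f\<rbrakk>
      \<Longrightarrow> derivation V P (X P) (\<lambda>Q. derivation V Q (Y Q) f)
          - derivation V P (Y P) (\<lambda>Q. derivation V Q (X Q) f)
        = derivation V P (\<nabla> P (X P) Y - \<nabla> P (Y P) X) f"
    and metric_compatible: "\<lbrakk>P \<in> nonisotropic_points V; t \<in> tangent_space V P; smooth_field V Y;
        smooth_field V Z\<rbrakk>
      \<Longrightarrow> derivation V P t (\<lambda>Q. metric V \<sigma> (Y Q) (Z Q))
        = metric V \<sigma> (\<nabla> P t Y) (Z P) + metric V \<sigma> (Y P) (\<nabla> P t Z)"


section \<open>Parallel transport\<close>

text \<open>A smooth curve \<open>s \<in> [0,1]\<close> of nonisotropic points is given by a smooth lift \<open>\<gamma>\<close> to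
  \<open>V \ {0}\<close>. Its velocity is the tangent vector sending \<open>\<gamma> s\<close> to the component of the derivative of
  \<open>\<gamma>\<close> orthogonal to \<open>\<gamma> s\<close>; as a derivation, it sends \<open>f\<close> to the derivative of
  \<open>\<lambda>s. f (line V (\<gamma> s))\<close>.\<close>

abbreviation derivative_on_01 :: "(real \<Rightarrow> 'b::real_normed_vector) \<Rightarrow> real \<Rightarrow> 'b" where
  "derivative_on_01 f s \<equiv> vector_derivative f (at s within {0..1})"

definition velocity ::
  "('k::rch, 'v::euclidean_space) hspace \<Rightarrow> (real \<Rightarrow> 'v) \<Rightarrow> real \<Rightarrow> ('v \<Rightarrow>\<^sub>L 'v)" where
  "velocity V \<gamma> s = Blinfun (\<lambda>v. proj V (\<gamma> s) (derivative_on_01 \<gamma> s)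
     \<cdot>\<^bsub>V\<^esub> (\<langle>\<gamma> s,v\<rangle>\<^bsub>V\<^esub> / \<langle>\<gamma> s,\<gamma> s\<rangle>\<^bsub>V\<^esub>))"

definition field_along ::
  "('k::rch, 'v::euclidean_space) hspace \<Rightarrow> (real \<Rightarrow> 'v) \<Rightarrow> (real \<Rightarrow> ('v \<Rightarrow>\<^sub>L 'v)) \<Rightarrow> bool" where
  "field_along V \<gamma> X \<longleftrightarrow>
     smooth_on {0..1} X \<and> (\<forall>s\<in>{0..1}. X s \<in> tangent_space V (line V (\<gamma> s)))"

text \<open>\<open>D\<close> is the covariant derivative of vector fields along \<open>\<gamma>\<close> induced by the connection. The
  congruence axiom says that \<open>D\<close> is an operator on fields over \<open>[0,1]\<close>: the values of the total
  functions outside this interval are irrelevant.\<close>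

locale covariant_derivative_along =
  fixes V :: "('k::rch, 'v::euclidean_space) hspace"
    and nabla :: "'v set \<Rightarrow> ('v \<Rightarrow>\<^sub>L 'v) \<Rightarrow> ('v set \<Rightarrow> ('v \<Rightarrow>\<^sub>L 'v)) \<Rightarrow> ('v \<Rightarrow>\<^sub>L 'v)" ("\<nabla>")
    and \<gamma> :: "real \<Rightarrow> 'v"
    and D :: "(real \<Rightarrow> ('v \<Rightarrow>\<^sub>L 'v)) \<Rightarrow> (real \<Rightarrow> ('v \<Rightarrow>\<^sub>L 'v))"
  assumes field: "field_along V \<gamma> X \<Longrightarrow> field_along V \<gamma> (D X)"
    and cong: "\<lbrakk>field_along V \<gamma> X; field_along V \<gamma> Y; \<And>s. s \<in> {0..1} \<Longrightarrow> X s = Y s; s \<in> {0..1}\<rbrakk>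
      \<Longrightarrow> D X s = D Y s"
    and add: "\<lbrakk>field_along V \<gamma> X; field_along V \<gamma> Y; s \<in> {0..1}\<rbrakk>
      \<Longrightarrow> D (\<lambda>s. X s + Y s) s = D X s + D Y s"
    and leibniz: "\<lbrakk>field_along V \<gamma> X; smooth_on {0..1} f; s \<in> {0..1}\<rbrakk>
      \<Longrightarrow> D (\<lambda>s. f s *\<^sub>R X s) s = derivative_on_01 f s *\<^sub>R X s + f s *\<^sub>R D X s"
    and induced: "\<lbrakk>smooth_field V Z; s \<in> {0..1}\<rbrakk>
      \<Longrightarrow> D (\<lambda>s. Z (line V (\<gamma> s))) s = \<nabla> (line V (\<gamma> s)) (velocity V \<gamma> s) Z"

definition parallel_along :: "('k::rch, 'v::euclidean_space) hspace
    \<Rightarrow> ('v set \<Rightarrow> ('v \<Rightarrow>\<^sub>L 'v) \<Rightarrow> ('v set \<Rightarrow> ('v \<Rightarrow>\<^sub>L 'v)) \<Rightarrow> ('v \<Rightarrow>\<^sub>L 'v))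
    \<Rightarrow> (real \<Rightarrow> 'v) \<Rightarrow> (real \<Rightarrow> ('v \<Rightarrow>\<^sub>L 'v)) \<Rightarrow> bool" where
  "parallel_along V nabla \<gamma> X \<longleftrightarrow> field_along V \<gamma> X \<and>
     (\<exists>D. covariant_derivative_along V nabla \<gamma> D \<and> (\<forall>s\<in>{0..1}. D X s = 0))"

definition parallel_transport :: "('k::rch, 'v::euclidean_space) hspace
    \<Rightarrow> ('v set \<Rightarrow> ('v \<Rightarrow>\<^sub>L 'v) \<Rightarrow> ('v set \<Rightarrow> ('v \<Rightarrow>\<^sub>L 'v)) \<Rightarrow> ('v \<Rightarrow>\<^sub>L 'v))
    \<Rightarrow> (real \<Rightarrow> 'v) \<Rightarrow> ('v \<Rightarrow>\<^sub>L 'v) \<Rightarrow> ('v \<Rightarrow>\<^sub>L 'v)" where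
  "parallel_transport V nabla \<gamma> t =
     (THE t'. \<exists>X. parallel_along V nabla \<gamma> X \<and> X 0 = t \<and> X 1 = t')"


section \<open>Lines, geodesics, spread fields\<close>

text \<open>A projective line is represented by the corresponding two-dimensional subspace.\<close>

definition span2 :: "('k::rch, 'v::euclidean_space) hspace \<Rightarrow> 'v \<Rightarrow> 'v \<Rightarrow> 'v set" where
  "span2 V p q = {p \<cdot>\<^bsub>V\<^esub> a + q \<cdot>\<^bsub>V\<^esub> b |a b. True}"

definition euclidean :: "('k::rch, 'v::euclidean_space) hspace \<Rightarrow> 'v set \<Rightarrow> bool" where
  "euclidean V L \<longleftrightarrow> (\<exists>v\<in>L. \<exists>w\<in>L. \<langle>v,w\<rangle>\<^bsub>V\<^esub> \<noteq> 0) \<and> (\<exists>v\<in>L. v \<noteq> 0 \<and> (\<forall>w\<in>L. \<langle>v,w\<rangle>\<^bsub>V\<^esub> = 0))"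

definition tangent_to_line ::
  "('k::rch, 'v::euclidean_space) hspace \<Rightarrow> 'v set \<Rightarrow> 'v set \<Rightarrow> ('v \<Rightarrow>\<^sub>L 'v) set" where
  "tangent_to_line V L P = {t \<in> tangent_space V P. \<forall>v\<in>P. t v \<in> L}"

definition normal_to_line ::
  "('k::rch, 'v::euclidean_space) hspace \<Rightarrow> real \<Rightarrow> 'v set \<Rightarrow> 'v set \<Rightarrow> ('v \<Rightarrow>\<^sub>L 'v) set" where
  "normal_to_line V \<sigma> L P =
     {v \<in> tangent_space V P. \<forall>h\<in>tangent_to_line V L P. metric V \<sigma> h v = 0}"

text \<open>The real subspaces \<open>W\<close> whose projectivizations \<open>line V ` (W - {0})\<close> are the geodesics.\<close>

definition geodesic_subspace :: "('k::rch, 'v::euclidean_space) hspace \<Rightarrow> 'v set \<Rightarrow> bool" where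
  "geodesic_subspace V W \<longleftrightarrow> subspace W \<and> dim W = 2 \<and>
     (\<forall>v\<in>W. \<forall>w\<in>W. \<langle>v,w\<rangle>\<^bsub>V\<^esub> \<in> \<real>) \<and> (\<exists>v\<in>W. \<exists>w\<in>W. \<langle>v,w\<rangle>\<^bsub>V\<^esub> \<noteq> 0)"

text \<open>\<open>\<gamma>\<close> is a smooth lift of a regular parametrization of the oriented segment \<open>G[p,q]\<close>: a simple
  arc from \<open>p\<close> to \<open>q\<close> in the geodesic through \<open>p\<close> and \<open>q\<close> that avoids the point of the circle
  orthogonal to \<open>p\<close>. Regularity means that the derivative of \<open>\<gamma>\<close> is not tangent to the fibres of the
  projection onto the projective space.\<close>

definition parametrizes_segment ::
  "('k::rch, 'v::euclidean_space) hspace \<Rightarrow> 'v \<Rightarrow> 'v \<Rightarrow> (real \<Rightarrow> 'v) \<Rightarrow> bool" where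
  "parametrizes_segment V p q \<gamma> \<longleftrightarrow>
     smooth_on {0..1} \<gamma> \<and>
     inj_on (\<lambda>s. line V (\<gamma> s)) {0..1} \<and>
     (\<forall>s\<in>{0..1}. \<gamma> s \<noteq> 0 \<and> derivative_on_01 \<gamma> s \<notin> line V (\<gamma> s)) \<and>
     line V (\<gamma> 0) = line V p \<and> line V (\<gamma> 1) = line V q \<and>
     (\<exists>W. geodesic_subspace V W \<and> (\<forall>s\<in>{0..1}. line V (\<gamma> s) \<in> line V ` (W - {0}))) \<and>
     (\<forall>s\<in>{0..1}. \<langle>p, \<gamma> s\<rangle>\<^bsub>V\<^esub> \<noteq> 0)"

text \<open>The value at \<open>x\<close> of the field spread from \<open>t\<close>.\<close>

definition spread :: "('k::rch, 'v::euclidean_space) hspace \<Rightarrow> ('v \<Rightarrow>\<^sub>L 'v) \<Rightarrow> 'v \<Rightarrow> ('v \<Rightarrow>\<^sub>L 'v)" where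
  "spread V t x = Blinfun (\<lambda>v. proj V x (t (proj' V x v)))"

text \<open>The scalar whose real part is taken is real.\<close>

definition ta :: "('k::rch, 'v::euclidean_space) hspace \<Rightarrow> 'v \<Rightarrow> 'v \<Rightarrow> real" where
  "ta V p x = re ((\<langle>p,x\<rangle>\<^bsub>V\<^esub> * \<langle>x,p\<rangle>\<^bsub>V\<^esub>) / (\<langle>p,p\<rangle>\<^bsub>V\<^esub> * \<langle>x,x\<rangle>\<^bsub>V\<^esub>))"

definition Tn ::
  "('k::rch, 'v::euclidean_space) hspace \<Rightarrow> 'v \<Rightarrow> ('v \<Rightarrow>\<^sub>L 'v) \<Rightarrow> 'v \<Rightarrow> ('v \<Rightarrow>\<^sub>L 'v)" where
  "Tn V p t x = spread V t x /\<^sub>R ta V p x"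

definition Ct ::
  "('k::rch, 'v::euclidean_space) hspace \<Rightarrow> 'v \<Rightarrow> ('v \<Rightarrow>\<^sub>L 'v) \<Rightarrow> 'v \<Rightarrow> ('v \<Rightarrow>\<^sub>L 'v)" where
  "Ct V p t x = spread V t x /\<^sub>R sqrt (ta V p x)"

end

theory Submission
  imports Defs
begin

text \<open>
  A tangent vector at the point of \<open>x\<close> is a rank-one map \<open>v \<mapsto> w \<langle>x, v\<rangle> / \<langle>x, x\<rangle>\<close> with \<open>w\<close>
  orthogonal to \<open>x\<close>, and is determined by its value \<open>w\<close> at \<open>x\<close> (\<open>tangent_eq_tvec\<close>). In these terms
  the metric is \<open>\<plusminus> re \<langle>w\<^sub>1, w\<^sub>2\<rangle> / \<langle>x, x\<rangle>\<close> (\<open>metric_eq\<close>), and a vector field is a map on \<open>V\<close> that is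
  constant on lines, so it can be differentiated in the flat space \<open>V\<close>.

  The Levi-Civita connection is this flat derivative followed by the projection to the tangent space
  (\<open>nabla_eq\<close>). Only its axioms are given, so the identification is a uniqueness argument of Koszul
  type: the difference of the two, paired with a third field, is symmetric in the first two arguments
  because both are torsion-free, and skew in the last two because both respect the metric, hence it
  vanishes. Torsion is tested on sufficiently many explicit functions.

  The covariant derivative along a curve is treated likewise. The projected derivative satisfies the
  axioms (\<open>covD_covariant_derivative\<close>), and no other operator does
  (\<open>covariant_derivative_unique\<close>), since fields along the curve are combinations with smooth
  coefficients of restrictions of global fields. The value of a parallel field on a lift of the curve
  solves a homogeneous linear differential equation. A parallel field is therefore determined by its
  initial value (\<open>parallel_along_unique\<close>), and it remains to exhibit one with the initial value \<open>t\<close>.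

  For this, the lift \<open>x\<close> of the segment with \<open>\<langle>p, x\<rangle> = \<langle>p, p\<rangle>\<close> is used. It has the form
  \<open>x = p + \<tau> e\<close> with \<open>e\<close> orthogonal to \<open>p\<close>, a real function \<open>\<tau>\<close> growing from \<open>0\<close> at \<open>p\<close> to \<open>1\<close>
  at \<open>q\<close> without leaving the interval between, and \<open>\<langle>x, x\<rangle> = N \<langle>p, p\<rangle>\<close> where
  \<open>N = 1 + \<mu> \<tau>\<^sup>2 > 0\<close> and \<open>\<mu> = \<langle>e, e\<rangle> / \<langle>p, p\<rangle>\<close> (\<open>segment_lift\<close>). If \<open>h p = e k\<close> and \<open>v p = u\<close>,
  then \<open>u\<close> is orthogonal to \<open>p\<close> and \<open>e\<close>, and the field with value \<open>(e - \<mu> \<tau> p) k + \<surd>N u\<close> at \<open>x\<close> is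
  parallel (\<open>parallel_along_segment\<close>). Since \<open>ta(p, x) = 1 / N\<close> and the projection of \<open>N e k\<close>
  orthogonally to \<open>x\<close> is \<open>(e - \<mu> \<tau> p) k\<close>, this field is \<open>Tn(h) + Ct(v)\<close>.
\<close>

section \<open>Scalars\<close>

lemma conj_of_real [simp]: "conj (of_real r :: 'k::rch) = of_real r"
proof (cases "r = 0")
  case True
  have "conj (0::'k) = 0"
    using conj_add[of "0::'k" 0] by simp
  then show ?thesis using True by simp
next
  case False
  have "conj (of_real r :: 'k) * of_real r = of_real r * of_real r"
    using conj_times_self[of "of_real r :: 'k"]
    by (simp add: scaleR_conv_of_real power2_eq_square)
  then show ?thesis using False by simp
qed

lemma conj_0 [simp]: "conj (0::'k::rch) = 0" and conj_1 [simp]: "conj (1::'k) = 1"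
  using conj_of_real[of 0, where 'k='k] conj_of_real[of 1, where 'k='k] by auto

lemma conj_scaleR: "conj (r *\<^sub>R x) = r *\<^sub>R conj (x::'k::rch)"
proof -
  have "of_real r * y = y * of_real r" for y :: 'k
    by (simp add: of_real_def)
  then show ?thesis
    using conj_mult[of "of_real r" x] by (simp add: scaleR_conv_of_real)
qed

lemma linear_conj: "linear (conj :: 'k::rch \<Rightarrow> 'k)"
  by (auto intro!: linearI simp: conj_add conj_scaleR)

lemma conj_diff: "conj (x - y) = conj x - conj (y::'k::rch)"
  by (rule linear_diff[OF linear_conj])

lemma norm_conj [simp]: "norm (conj x) = norm (x::'k::rch)"
proof (cases "x = 0")
  case False
  have "norm (conj x) * norm x = norm x * norm x"
    using arg_cong[OF conj_times_self[of x], of norm]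
    by (simp add: norm_mult power2_eq_square)
  then show ?thesis using False by simp
qed simp

lemma times_conj_self: "x * conj x = (norm (x::'k::rch))\<^sup>2 *\<^sub>R 1"
  using conj_times_self[of "conj x"] by (simp add: conj_conj)

lemma re_add: "re (x + y) = re x + re (y::'k::rch)"
  and re_diff: "re (x - y) = re x - re y"
  and re_minus: "re (- x) = - re x"
  and re_scaleR: "re (r *\<^sub>R x) = r * re x"
  and re_0 [simp]: "re 0 = 0"
  by (simp_all add: re_def inner_add_left inner_diff_left)

lemma re_of_real [simp]: "re (of_real r :: 'k::rch) = r"
  by (simp add: re_def of_real_def dot_square_norm)

text \<open>Polarization of \<open>conj x * x = (norm x)\<^sup>2\<close>.\<close>

lemma conj_mult_add: "conj x * y + conj y * x = (2 * (x \<bullet> y)) *\<^sub>R (1::'k::rch)"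
proof -
  have "conj (x + y) * (x + y) = (norm (x + y))\<^sup>2 *\<^sub>R 1"
    by (rule conj_times_self)
  then have "conj x * x + (conj x * y + conj y * x) + conj y * y
      = (norm (x + y))\<^sup>2 *\<^sub>R (1::'k)"
    by (simp add: conj_add algebra_simps)
  then have *: "conj x * y + conj y * x
      = (norm (x + y))\<^sup>2 *\<^sub>R (1::'k) - (norm x)\<^sup>2 *\<^sub>R 1 - (norm y)\<^sup>2 *\<^sub>R 1"
    by (simp add: conj_times_self algebra_simps)
  have "(norm (x + y))\<^sup>2 - (norm x)\<^sup>2 - (norm y)\<^sup>2 = 2 * (x \<bullet> y)"
    by (simp add: power2_norm_eq_inner inner_add_left inner_add_right inner_commute)
  then show ?thesis
    unfolding * scaleR_diff_left[symmetric] by simp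
qed

lemma add_conj: "x + conj x = of_real (2 * re (x::'k::rch))"
  using conj_mult_add[of 1 x] by (simp add: re_def inner_commute of_real_def)

lemma re_conj [simp]: "re (conj x) = re (x::'k::rch)"
proof -
  have "of_real (2 * re (conj x)) = (of_real (2 * re x) :: 'k)"
    using add_conj[of x] add_conj[of "conj x"] by (simp only: conj_conj add.commute)
  then show ?thesis by (simp only: of_real_eq_iff)
qed

lemma inner_eq_re_conj_mult: "x \<bullet> y = re (conj x * (y::'k::rch))"
proof -
  have "conj x * y + conj (conj x * y) = of_real (2 * (x \<bullet> y))"
    using conj_mult_add[of x y] by (simp add: conj_mult conj_conj of_real_def)
  then have "of_real (2 * re (conj x * y)) = (of_real (2 * (x \<bullet> y)) :: 'k)"
    by (simp only: add_conj)
  then show ?thesis by (simp only: of_real_eq_iff)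
qed

lemma inner_conj_conj: "conj x \<bullet> conj y = x \<bullet> (y::'k::rch)"
proof -
  have "(norm (conj x + conj y))\<^sup>2 = (norm (x + y))\<^sup>2"
    by (simp flip: conj_add)
  then show ?thesis
    by (simp add: dot_norm)
qed

text \<open>Both sides are the inner product of \<open>conj x\<close> and \<open>y\<close>. This is all the commutativity
  that is left over the quaternions.\<close>

lemma re_mult_commute: "re (x * y) = re (y * (x::'k::rch))"
proof -
  have "re (x * y) = conj x \<bullet> y"
    by (simp add: inner_eq_re_conj_mult conj_conj)
  also have "\<dots> = x \<bullet> conj y"
    by (metis inner_conj_conj conj_conj)
  also have "\<dots> = re (y * x)"
    by (metis inner_commute inner_eq_re_conj_mult conj_conj)
  finally show ?thesis .
qed

lemma conj_eq_self_iff: "conj x = x \<longleftrightarrow> x = of_real (re (x::'k::rch))"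
proof
  assume "conj x = x"
  then have "x + x = of_real (re x) + of_real (re x)"
    using add_conj[of x] by (simp flip: of_real_add)
  then have "2 *\<^sub>R x = 2 *\<^sub>R of_real (re x)"
    by (simp add: scaleR_2)
  then show "x = of_real (re x)" by simp
qed (metis conj_of_real)

lemma re_mult_eq_0_imp: "(\<And>k. re (x * k) = 0) \<Longrightarrow> x = (0::'k::rch)"
  using inner_eq_re_conj_mult[of "conj x" "conj x"] by (metis conj_0 conj_conj inner_eq_zero_iff)

lemma divide_of_real: "x / of_real r = (1 / r) *\<^sub>R (x :: 'k::rch)"
proof -
  have "x / of_real r = x * of_real (inverse r)"
    by (simp add: divide_inverse)
  then show ?thesis by (simp add: of_real_def divide_inverse)
qed

text \<open>Left multiplication by \<open>k\<close> has the same diagonal entry \<open>re k\<close> in every unit direction.\<close>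

lemma trace_left_mult: "(\<Sum>c\<in>Basis. (k * c) \<bullet> c) = DIM('k) * re (k::'k::rch)"
proof -
  have "(k * c) \<bullet> c = re k" if "c \<in> Basis" for c
  proof -
    have "(k * c) \<bullet> c = re (conj c * (k * c))"
      by (metis inner_commute inner_eq_re_conj_mult)
    also have "\<dots> = re (k * (c * conj c))"
      by (metis re_mult_commute mult.assoc)
    finally show ?thesis using that by (simp add: times_conj_self re_scaleR)
  qed
  then show ?thesis by simp
qed


section \<open>Smooth maps\<close>

lemma Ck_on_SucD: "Ck_on (Suc n) U f \<Longrightarrow> Ck_on n U f"
proof (induction n arbitrary: f)
  case 0
  then show ?case
    by (auto simp: continuous_on_eq_continuous_within
        intro: differentiable_imp_continuous_within differentiable_at_withinI)
next
  case (Suc n)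
  then have "\<forall>x\<in>U. f differentiable at x"
    "\<And>v. Ck_on (Suc n) U (\<lambda>x. frechet_derivative f (at x) v)"
    by simp_all
  then show ?case using Suc.IH by simp
qed

lemma Ck_on_subset: "Ck_on n U f \<Longrightarrow> U' \<subseteq> U \<Longrightarrow> Ck_on n U' f"
  by (induction n arbitrary: f) (auto intro: continuous_on_subset)

lemma Ck_on_cong:
  assumes "open U" "Ck_on n U f" "\<And>x. x \<in> U \<Longrightarrow> f x = g x"
  shows "Ck_on n U g"
  using assms(2,3)
proof (induction n arbitrary: f g)
  case 0
  then show ?case using continuous_on_cong by force
next
  case (Suc n)
  have f: "f differentiable at x" if "x \<in> U" for x
    using Suc.prems that by simp
  have "frechet_derivative f (at x) = frechet_derivative g (at x)" if "x \<in> U" for x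
    using frechet_derivative_transform_within_open[OF f assms(1) _ Suc.prems(2)] that by blast
  moreover have "g differentiable at x" if "x \<in> U" for x
    using has_derivative_transform_within_open[of f, OF _ assms(1) that Suc.prems(2)] f[OF that]
    unfolding differentiable_def by metis
  ultimately show ?case
    using Suc.prems(1) Suc.IH[of "\<lambda>x. frechet_derivative f (at x) v"
        "\<lambda>x. frechet_derivative g (at x) v" for v] by simp
qed

lemma Ck_on_SucI:
  assumes "open U" "\<And>x. x \<in> U \<Longrightarrow> (f has_derivative f' x) (at x)"
    "\<And>v. Ck_on n U (\<lambda>x. f' x v)"
  shows "Ck_on (Suc n) U f"
proof -
  have "frechet_derivative f (at x) = f' x" if "x \<in> U" for x
    using frechet_derivative_at[OF assms(2)[OF that]] by simp
  then show ?thesis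
    using assms(2) Ck_on_cong[OF assms(1) assms(3)] by (auto simp: differentiable_def)
qed

lemma Ck_on_SucE:
  assumes "Ck_on (Suc n) U f" "x \<in> U"
  shows "(f has_derivative frechet_derivative f (at x)) (at x)"
  using assms by (simp add: frechet_derivative_works)

lemma Ck_on_const: "open U \<Longrightarrow> Ck_on n U (\<lambda>x. c)"
  by (induction n arbitrary: c) auto

lemma Ck_on_linear:
  assumes "open U" "bounded_linear h" "Ck_on n U f"
  shows "Ck_on n U (\<lambda>x. h (f x))"
  using assms(3)
proof (induction n arbitrary: f)
  case 0
  then show ?case
    by (simp add: bounded_linear.continuous_on[OF assms(2)])
next
  case (Suc n)
  show ?case
  proof (rule Ck_on_SucI[OF assms(1)])
    show "((\<lambda>x. h (f x)) has_derivative (\<lambda>v. h (frechet_derivative f (at x) v))) (at x)"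
      if "x \<in> U" for x
      by (rule bounded_linear.has_derivative[OF assms(2) Ck_on_SucE[OF Suc.prems that]])
  qed (use Suc in simp)
qed

lemma Ck_on_ident: "open U \<Longrightarrow> Ck_on n U (\<lambda>x. x)"
  by (cases n) (auto intro: Ck_on_const)

lemma Ck_on_add:
  assumes "open U" "Ck_on n U f" "Ck_on n U g"
  shows "Ck_on n U (\<lambda>x. f x + g x)"
  using assms(2,3)
proof (induction n arbitrary: f g)
  case 0
  then show ?case by (simp add: continuous_on_add)
next
  case (Suc n)
  show ?case
  proof (rule Ck_on_SucI[OF assms(1)])
    show "((\<lambda>x. f x + g x) has_derivative
        (\<lambda>v. frechet_derivative f (at x) v + frechet_derivative g (at x) v)) (at x)"
      if "x \<in> U" for x
      by (rule has_derivative_add[OF Ck_on_SucE[OF Suc.prems(1) that] Ck_on_SucE[OF Suc.prems(2) that]])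
  qed (use Suc in simp)
qed

text \<open>The derivative of a bilinear expression is a sum of two expressions of the same form, so that the
  claim follows by induction on the order for all pairs of maps at once.\<close>

lemma Ck_on_bilinear:
  assumes "open U" "bounded_bilinear h" "Ck_on n U f" "Ck_on n U g"
  shows "Ck_on n U (\<lambda>x. h (f x) (g x))"
  using assms(3,4)
proof (induction n arbitrary: f g)
  case 0
  then show ?case by (simp add: bounded_bilinear.continuous_on[OF assms(2)])
next
  case (Suc n)
  show ?case
  proof (rule Ck_on_SucI[OF assms(1)])
    show "((\<lambda>x. h (f x) (g x)) has_derivative
        (\<lambda>v. h (f x) (frechet_derivative g (at x) v) + h (frechet_derivative f (at x) v) (g x))) (at x)"
      if "x \<in> U" for x
      by (rule bounded_bilinear.FDERIV[OF assms(2) Ck_on_SucE[OF Suc.prems(1) that]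
            Ck_on_SucE[OF Suc.prems(2) that]])
    show "Ck_on n U (\<lambda>x. h (f x) (frechet_derivative g (at x) v)
        + h (frechet_derivative f (at x) v) (g x))" for v
      using Suc.prems Suc.prems[THEN Ck_on_SucD] by (intro Ck_on_add Suc.IH assms(1)) simp_all
  qed
qed

text \<open>The derivative of \<open>1 / f\<close> is a polynomial in \<open>1 / f\<close> and the derivative of \<open>f\<close>, to which the
  induction hypothesis for \<open>1 / f\<close> itself applies. The square root is treated in the same way.\<close>

lemma Ck_on_inverse:
  fixes f :: "'a::euclidean_space \<Rightarrow> real"
  assumes "open U" "\<And>x. x \<in> U \<Longrightarrow> f x \<noteq> 0" "Ck_on n U f"
  shows "Ck_on n U (\<lambda>x. inverse (f x))"
  using assms(3)
proof (induction n)
  case 0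
  then show ?case using assms(2) by (simp add: continuous_on_inverse)
next
  case (Suc n)
  show ?case
  proof (rule Ck_on_SucI[OF assms(1)])
    show "((\<lambda>x. inverse (f x)) has_derivative
        (\<lambda>v. - 1 * (inverse (f x) * (frechet_derivative f (at x) v * inverse (f x))))) (at x)"
      if "x \<in> U" for x
      using Deriv.has_derivative_inverse[OF assms(2)[OF that] Ck_on_SucE[OF Suc.prems that]]
      by (simp add: mult.assoc)
    show "Ck_on n U (\<lambda>x. - 1 * (inverse (f x) * (frechet_derivative f (at x) v * inverse (f x))))" for v
      using Suc.prems
      by (intro Ck_on_bilinear[OF assms(1) bounded_bilinear_mult] Ck_on_const assms(1)
          Suc.IH Ck_on_SucD[OF Suc.prems]) auto
  qed
qed

lemma Ck_on_sqrt:
  fixes f :: "'a::euclidean_space \<Rightarrow> real"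
  assumes "open U" "\<And>x. x \<in> U \<Longrightarrow> f x > 0" "Ck_on n U f"
  shows "Ck_on n U (\<lambda>x. sqrt (f x))"
  using assms(3)
proof (induction n)
  case 0
  then show ?case by (simp add: continuous_on_real_sqrt)
next
  case (Suc n)
  show ?case
  proof (rule Ck_on_SucI[OF assms(1)])
    show "((\<lambda>x. sqrt (f x)) has_derivative
        (\<lambda>v. frechet_derivative f (at x) v * (1/2 * inverse (sqrt (f x))))) (at x)"
      if "x \<in> U" for x
      using has_derivative_real_sqrt[OF assms(2)[OF that] Ck_on_SucE[OF Suc.prems that]]
      by (simp add: field_simps)
    show "Ck_on n U (\<lambda>x. frechet_derivative f (at x) v * (1/2 * inverse (sqrt (f x))))" for v
      using Suc.prems assms(2)
      by (intro Ck_on_bilinear[OF assms(1) bounded_bilinear_mult] Ck_on_const Ck_on_inverse assms(1)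
          Suc.IH Ck_on_SucD[OF Suc.prems]) (auto simp: less_imp_neq[symmetric])
  qed
qed

lemma smooth_onD_open: "open S \<Longrightarrow> smooth_on S f \<Longrightarrow> Ck_on n S f"
  unfolding smooth_on_def by (metis Ck_on_subset Ck_on_cong)

lemma smooth_on_cong: "smooth_on S f \<Longrightarrow> (\<And>x. x \<in> S \<Longrightarrow> f x = g x) \<Longrightarrow> smooth_on S g"
  unfolding smooth_on_def by metis

lemma smooth_on_const: "smooth_on S (\<lambda>x. c)"
  unfolding smooth_on_def using Ck_on_const by blast

lemma smooth_on_ident: "smooth_on S (\<lambda>x. x)"
  unfolding smooth_on_def using Ck_on_ident by blast

lemma smooth_on_bilinear:
  assumes h: "bounded_bilinear h" and "smooth_on S f" "smooth_on S g"
  shows "smooth_on S (\<lambda>x. h (f x) (g x))"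
proof -
  obtain U F where U: "open U" "S \<subseteq> U" "\<And>n. Ck_on n U F" "\<And>x. x \<in> S \<Longrightarrow> F x = f x"
    using assms(2) unfolding smooth_on_def by metis
  obtain W G where W: "open W" "S \<subseteq> W" "\<And>n. Ck_on n W G" "\<And>x. x \<in> S \<Longrightarrow> G x = g x"
    using assms(3) unfolding smooth_on_def by metis
  have "Ck_on n (U \<inter> W) (\<lambda>x. h (F x) (G x))" for n
    by (rule Ck_on_bilinear[OF open_Int[OF U(1) W(1)] h Ck_on_subset[OF U(3) Int_lower1]
          Ck_on_subset[OF W(3) Int_lower2]])
  then show ?thesis
    unfolding smooth_on_def using U W
    by (intro exI[of _ "U \<inter> W"] exI[of _ "\<lambda>x. h (F x) (G x)"]) auto
qed

lemma smooth_on_add: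
  assumes "smooth_on S f" "smooth_on S g"
  shows "smooth_on S (\<lambda>x. f x + g x)"
proof -
  obtain U F where U: "open U" "S \<subseteq> U" "\<And>n. Ck_on n U F" "\<And>x. x \<in> S \<Longrightarrow> F x = f x"
    using assms(1) unfolding smooth_on_def by metis
  obtain W G where W: "open W" "S \<subseteq> W" "\<And>n. Ck_on n W G" "\<And>x. x \<in> S \<Longrightarrow> G x = g x"
    using assms(2) unfolding smooth_on_def by metis
  have "Ck_on n (U \<inter> W) (\<lambda>x. F x + G x)" for n
    by (rule Ck_on_add[OF open_Int[OF U(1) W(1)] Ck_on_subset[OF U(3) Int_lower1]
          Ck_on_subset[OF W(3) Int_lower2]])
  then show ?thesis
    unfolding smooth_on_def using U W
    by (intro exI[of _ "U \<inter> W"] exI[of _ "\<lambda>x. F x + G x"]) auto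
qed

lemma smooth_on_linear:
  assumes "bounded_linear h" "smooth_on S f"
  shows "smooth_on S (\<lambda>x. h (f x))"
proof -
  obtain U F where U: "open U" "S \<subseteq> U" "\<And>n. Ck_on n U F" "\<And>x. x \<in> S \<Longrightarrow> F x = f x"
    using assms(2) unfolding smooth_on_def by metis
  then show ?thesis
    unfolding smooth_on_def
    by (intro exI[of _ U] exI[of _ "\<lambda>x. h (F x)"]) (auto intro: Ck_on_linear[OF _ assms(1)])
qed

lemma smooth_on_diff: "smooth_on S f \<Longrightarrow> smooth_on S g \<Longrightarrow> smooth_on S (\<lambda>x. f x - g x)"
  using smooth_on_add[of S f "\<lambda>x. - g x"]
    smooth_on_linear[OF bounded_linear_minus[OF bounded_linear_ident], of S g]
  by simp

lemmas smooth_on_scaleR = smooth_on_bilinear[OF bounded_bilinear_scaleR]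
lemmas smooth_on_mult = smooth_on_bilinear[OF bounded_bilinear_mult]
lemmas smooth_on_inner = smooth_on_bilinear[OF bounded_bilinear_inner]
lemmas smooth_on_blinfun_apply = smooth_on_bilinear[OF bounded_bilinear_blinfun_apply]

lemma open_Collect_continuous_on:
  assumes "open U" "continuous_on U (f :: 'a::euclidean_space \<Rightarrow> real)" "open T"
  shows "open {x \<in> U. f x \<in> T}"
  using continuous_open_preimage[OF assms(2,1,3)] by (simp add: vimage_def Int_def)

text \<open>A smooth extension keeps the open condition in a neighbourhood, so it suffices to shrink its
  domain.\<close>

lemma smooth_on_inverse:
  fixes f :: "'a::euclidean_space \<Rightarrow> real"
  assumes "smooth_on S f" "\<And>x. x \<in> S \<Longrightarrow> f x \<noteq> 0"
  shows "smooth_on S (\<lambda>x. inverse (f x))"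
proof -
  obtain U F where U: "open U" "S \<subseteq> U" "\<And>n. Ck_on n U F" "\<And>x. x \<in> S \<Longrightarrow> F x = f x"
    using assms(1) unfolding smooth_on_def by metis
  let ?U = "{x \<in> U. F x \<in> - {0}}"
  have o: "open ?U"
    using U(1) U(3)[of 0] by (intro open_Collect_continuous_on) auto
  have "Ck_on n ?U (\<lambda>x. inverse (F x))" for n
    by (rule Ck_on_inverse[OF o _ Ck_on_subset[OF U(3)]]) auto
  then show ?thesis
    unfolding smooth_on_def using o U assms(2)
    by (intro exI[of _ ?U] exI[of _ "\<lambda>x. inverse (F x)"]) auto
qed

lemma smooth_on_sqrt:
  fixes f :: "'a::euclidean_space \<Rightarrow> real"
  assumes "smooth_on S f" "\<And>x. x \<in> S \<Longrightarrow> f x > 0"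
  shows "smooth_on S (\<lambda>x. sqrt (f x))"
proof -
  obtain U F where U: "open U" "S \<subseteq> U" "\<And>n. Ck_on n U F" "\<And>x. x \<in> S \<Longrightarrow> F x = f x"
    using assms(1) unfolding smooth_on_def by metis
  let ?U = "{x \<in> U. F x \<in> {0<..}}"
  have o: "open ?U"
    using U(1) U(3)[of 0] by (intro open_Collect_continuous_on) auto
  have "Ck_on n ?U (\<lambda>x. sqrt (F x))" for n
    by (rule Ck_on_sqrt[OF o _ Ck_on_subset[OF U(3)]]) auto
  then show ?thesis
    unfolding smooth_on_def using o U assms(2)
    by (intro exI[of _ ?U] exI[of _ "\<lambda>x. sqrt (F x)"]) auto
qed

lemma smooth_on_imp_continuous_on: "smooth_on S f \<Longrightarrow> continuous_on S f"
proof -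
  assume "smooth_on S f"
  then obtain U F where U: "S \<subseteq> U" "Ck_on 0 U F" "\<And>x. x \<in> S \<Longrightarrow> F x = f x"
    unfolding smooth_on_def by metis
  then show ?thesis
    by (metis Ck_on.simps(1) continuous_on_cong continuous_on_subset)
qed

lemma smooth_on_open_has_derivative:
  assumes "open S" "smooth_on S f" "x \<in> S"
  shows "(f has_derivative frechet_derivative f (at x)) (at x)"
  using Ck_on_SucE[OF smooth_onD_open[OF assms(1,2)] assms(3)] .

lemma derivative_on_01_eqI:
  assumes "(f has_vector_derivative d) (at s within {0..1})" "s \<in> {0..1}"
  shows "derivative_on_01 f s = d"
  using vector_derivative_within_cbox[of 0 1 s f d] assms by (simp add: cbox_interval)

text \<open>Derivatives within the unit interval are unique, hence those of \<open>f\<close> are the derivatives of any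
  smooth extension. This is how smoothness passes to the derivative along a curve.\<close>

lemma smooth_on_01_extension:
  assumes "smooth_on {0..1::real} f"
  obtains U F where "open U" "{0..1} \<subseteq> U" "\<And>n. Ck_on n U F" "\<And>s. s \<in> {0..1} \<Longrightarrow> F s = f s"
    "\<And>s. s \<in> {0..1} \<Longrightarrow>
      (f has_vector_derivative frechet_derivative F (at s) 1) (at s within {0..1})"
proof -
  obtain U F where U: "open U" "{0..1} \<subseteq> U" "\<And>n. Ck_on n U F" "\<And>x. x \<in> {0..1} \<Longrightarrow> F x = f x"
    using assms unfolding smooth_on_def by metis
  have "(f has_vector_derivative frechet_derivative F (at s) 1) (at s within {0..1})"
    if s: "s \<in> {0..1}" for s
  proof -
    have d: "(F has_derivative frechet_derivative F (at s)) (at s)"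
      by (rule Ck_on_SucE[OF U(3)]) (use U(2) s in blast)
    have "frechet_derivative F (at s) r = r *\<^sub>R frechet_derivative F (at s) 1" for r
      using linear_scale[OF has_derivative_linear[OF d], of r 1] by (metis mult.right_neutral real_scaleR_def)
    then have "(F has_vector_derivative frechet_derivative F (at s) 1) (at s)"
      unfolding has_vector_derivative_def by (intro has_derivative_eq_rhs[OF d] ext)
    then have "(F has_vector_derivative frechet_derivative F (at s) 1) (at s within {0..1})"
      by (rule has_vector_derivative_at_within)
    then show ?thesis
      by (rule has_vector_derivative_transform[OF s, rotated]) (simp add: U(4))
  qed
  then show ?thesis using that[OF U] by blast
qed

lemma smooth_on_01_has_vector_derivative:
  assumes "smooth_on {0..1::real} f" "s \<in> {0..1}"
  shows "(f has_vector_derivative derivative_on_01 f s) (at s within {0..1})"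
proof -
  obtain d where "(f has_vector_derivative d) (at s within {0..1})"
    using smooth_on_01_extension[OF assms(1)] assms(2) by metis
  then show ?thesis using derivative_on_01_eqI assms(2) by metis
qed

lemma smooth_on_01_derivative:
  assumes "smooth_on {0..1::real} f"
  shows "smooth_on {0..1} (derivative_on_01 f)"
proof -
  obtain U F where U: "open U" "{0..1} \<subseteq> U" "\<And>n. Ck_on n U F"
    and d: "\<And>s. s \<in> {0..1} \<Longrightarrow>
      (f has_vector_derivative frechet_derivative F (at s) 1) (at s within {0..1})"
    using smooth_on_01_extension[OF assms] by metis
  have "Ck_on n U (\<lambda>s. frechet_derivative F (at s) 1)" for n
    using U(3)[of "Suc n"] by simp
  then show ?thesis
    unfolding smooth_on_def using U derivative_on_01_eqI[OF d]
    by (intro exI[of _ U] exI[of _ "\<lambda>s. frechet_derivative F (at s) 1"]) auto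
qed


section \<open>Hermitian spaces and tangent vectors\<close>

text \<open>This identity for maps between two different spaces reduces the trace of a rank-one map on \<open>V\<close>
  to a trace on the scalars.\<close>

lemma trace_comp_commute:
  fixes A :: "'a::euclidean_space \<Rightarrow> 'b::euclidean_space" and B :: "'b \<Rightarrow> 'a"
  assumes "linear A" "linear B"
  shows "(\<Sum>b\<in>Basis. A (B b) \<bullet> b) = (\<Sum>c\<in>Basis. B (A c) \<bullet> c)"
proof -
  have "A (B b) = (\<Sum>c\<in>Basis. (B b \<bullet> c) *\<^sub>R A c)" for b
    by (subst euclidean_representation[of "B b", symmetric])
      (simp add: linear_sum[OF assms(1)] linear_scale[OF assms(1)])
  moreover have "B (A c) = (\<Sum>b\<in>Basis. (A c \<bullet> b) *\<^sub>R B b)" for c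
    by (subst euclidean_representation[of "A c", symmetric])
      (simp add: linear_sum[OF assms(2)] linear_scale[OF assms(2)])
  ultimately have "(\<Sum>b\<in>Basis. A (B b) \<bullet> b) = (\<Sum>b\<in>Basis. \<Sum>c\<in>Basis. (B b \<bullet> c) * (A c \<bullet> b))"
    "(\<Sum>c\<in>Basis. B (A c) \<bullet> c) = (\<Sum>c\<in>Basis. \<Sum>b\<in>Basis. (A c \<bullet> b) * (B b \<bullet> c))"
    by (simp_all add: inner_sum_left)
  then show ?thesis
    by (simp add: mult.commute sum.swap[of _ "Basis :: 'a set"])
qed

context hermitian_space
begin

lemma smul_1 [simp]: "v \<cdot> 1 = v"
  using smul_of_real[of v 1] by simp

lemma smul_scaleR_right: "v \<cdot> (r *\<^sub>R k) = r *\<^sub>R (v \<cdot> k)"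
proof -
  have "k * of_real r = r *\<^sub>R k" by (simp add: of_real_def)
  then show ?thesis
    using smul_smul[of v k "of_real r"] by (simp add: smul_of_real)
qed

lemma smul_scaleR_left: "(r *\<^sub>R v) \<cdot> k = r *\<^sub>R (v \<cdot> k)"
  using smul_smul[of v "of_real r" k] smul_scaleR_right[of v r k]
  by (simp add: smul_of_real scaleR_conv_of_real)

lemma herm_scaleR_left: "\<langle>r *\<^sub>R v, w\<rangle> = r *\<^sub>R \<langle>v, w\<rangle>"
  using herm_smul_left[of v "of_real r" w] by (simp add: smul_of_real scaleR_conv_of_real)

lemma herm_scaleR_right: "\<langle>v, r *\<^sub>R w\<rangle> = r *\<^sub>R \<langle>v, w\<rangle>"
proof -
  have "\<langle>v, w\<rangle> * of_real r = r *\<^sub>R \<langle>v, w\<rangle>" by (simp add: of_real_def)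
  then show ?thesis
    using herm_smul_right[of v w "of_real r"] by (simp add: smul_of_real)
qed

lemma bounded_bilinear_smul: "bounded_bilinear (\<lambda>v k. v \<cdot> k)"
  unfolding bilinear_conv_bounded_bilinear[symmetric]
  by (auto intro!: linearI simp: bilinear_def smul_add_left smul_add_right smul_scaleR_left
      smul_scaleR_right)

lemma bounded_bilinear_herm: "bounded_bilinear (\<lambda>v w. \<langle>v, w\<rangle>)"
  unfolding bilinear_conv_bounded_bilinear[symmetric]
  by (auto intro!: linearI simp: bilinear_def herm_add_left herm_add_right herm_scaleR_left
      herm_scaleR_right)

lemmas smul_simps [simp] =
  bounded_bilinear.zero_left[OF bounded_bilinear_smul]
  bounded_bilinear.zero_right[OF bounded_bilinear_smul]
lemmas smul_diff_left = bounded_bilinear.diff_left[OF bounded_bilinear_smul]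
lemmas smul_minus_right = bounded_bilinear.minus_right[OF bounded_bilinear_smul]
lemmas herm_simps [simp] =
  bounded_bilinear.zero_left[OF bounded_bilinear_herm]
  bounded_bilinear.zero_right[OF bounded_bilinear_herm]
lemmas herm_diff_left = bounded_bilinear.diff_left[OF bounded_bilinear_herm]
lemmas herm_diff_right = bounded_bilinear.diff_right[OF bounded_bilinear_herm]

lemma herm_eq_0_commute: "\<langle>v, w\<rangle> = 0 \<longleftrightarrow> \<langle>w, v\<rangle> = 0"
  using herm_conj[of v w] herm_conj[of w v] by auto

lemma re_herm_commute: "re \<langle>v, w\<rangle> = re \<langle>w, v\<rangle>"
  using herm_conj[of v w] by (metis re_conj)

lemma smul_inverse_cancel: "k \<noteq> 0 \<Longrightarrow> (v \<cdot> k) \<cdot> inverse k = v"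
  by (simp flip: smul_smul)

text \<open>Since all multiples of a vector by scalars are available, the real part of the form is already
  nondegenerate.\<close>

lemma re_herm_nondegenerate: "(\<And>w. re \<langle>v, w\<rangle> = 0) \<Longrightarrow> v = 0"
proof (rule herm_nondegenerate)
  fix w
  assume *: "\<And>w. re \<langle>v, w\<rangle> = 0"
  show "\<langle>v, w\<rangle> = 0"
    by (rule re_mult_eq_0_imp) (metis * herm_smul_right)
qed

text \<open>The quadratic form of the hermitian form. It is real-valued, and its sign is the signature of a
  point.\<close>

definition qf :: "'v \<Rightarrow> real" where "qf x = re \<langle>x, x\<rangle>"

lemma herm_self: "\<langle>x, x\<rangle> = of_real (qf x)"
  unfolding qf_def conj_eq_self_iff[symmetric] by (rule herm_conj[symmetric])

lemma nonisotropic_iff: "nonisotropic V x \<longleftrightarrow> qf x \<noteq> 0"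
  by (simp add: nonisotropic_def herm_self)

lemma qf_zero [simp]: "qf 0 = 0"
  by (simp add: qf_def)

lemma qf_nonzero_imp: "qf x \<noteq> 0 \<Longrightarrow> x \<noteq> 0"
  by auto

lemma qf_smul: "qf (x \<cdot> k) = (norm k)\<^sup>2 * qf x"
proof -
  have "\<langle>x \<cdot> k, x \<cdot> k\<rangle> = conj k * (\<langle>x, x\<rangle> * k)"
    by (simp only: herm_smul_left herm_smul_right mult.assoc)
  also have "\<dots> = of_real ((norm k)\<^sup>2 * qf x)"
    unfolding herm_self[of x] of_real_def by (simp add: conj_times_self)
  finally show ?thesis
    by (simp only: qf_def[of "x \<cdot> k"] re_of_real)
qed

lemma bounded_bilinear_re_herm: "bounded_bilinear (\<lambda>v w. re \<langle>v, w\<rangle>)"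
  unfolding bilinear_conv_bounded_bilinear[symmetric]
  by (auto intro!: linearI simp: bilinear_def herm_add_left herm_add_right herm_scaleR_left
      herm_scaleR_right re_add re_scaleR)

lemma continuous_on_qf: "continuous_on S qf"
  unfolding qf_def[abs_def]
  by (intro bounded_bilinear.continuous_on[OF bounded_bilinear_re_herm] continuous_on_id)

lemma open_nonisotropic: "open {x. nonisotropic V x}"
  unfolding nonisotropic_iff
  using open_Collect_continuous_on[of UNIV qf "- {0}"] continuous_on_qf by auto

lemma has_derivative_qf: "(qf has_derivative (\<lambda>u. 2 * re \<langle>x, u\<rangle>)) (at x)"
  unfolding qf_def[abs_def]
  by (rule has_derivative_eq_rhs[OF bounded_bilinear.FDERIV[OF bounded_bilinear_re_herm
          has_derivative_ident has_derivative_ident]])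
    (auto simp: re_herm_commute)


subsection \<open>Orthogonal projections\<close>

lemma proj'_eq: "proj' V x v = (1 / qf x) *\<^sub>R (x \<cdot> \<langle>x, v\<rangle>)"
  by (simp add: proj'_def herm_self divide_of_real smul_scaleR_right)

lemma proj_eq: "proj V x v = v - (1 / qf x) *\<^sub>R (x \<cdot> \<langle>x, v\<rangle>)"
  by (simp add: proj_def proj'_eq)

lemma proj_orthogonal [simp]: "\<langle>x, v\<rangle> = 0 \<Longrightarrow> proj V x v = v"
  by (simp add: proj_eq)

lemma herm_proj: "qf x \<noteq> 0 \<Longrightarrow> \<langle>x, proj V x v\<rangle> = 0"
  by (simp add: proj_eq herm_diff_right herm_scaleR_right herm_smul_right herm_self of_real_def)

lemma proj_add: "proj V x (v + w) = proj V x v + proj V x w"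
  by (simp add: proj_eq herm_add_right smul_add_right algebra_simps)

lemma proj_diff: "proj V x (v - w) = proj V x v - proj V x w"
  using proj_add[of x "v - w" w] by simp

lemma proj_scaleR: "proj V x (r *\<^sub>R v) = r *\<^sub>R proj V x v"
  by (simp add: proj_eq herm_scaleR_right smul_scaleR_right algebra_simps)

lemma proj_smul: "proj V x (v \<cdot> k) = proj V x v \<cdot> k"
  by (simp add: proj_eq herm_smul_right smul_smul smul_diff_left smul_scaleR_left)

lemma proj_self: "qf x \<noteq> 0 \<Longrightarrow> proj V x (x \<cdot> k) = 0"
  by (simp add: proj_eq herm_smul_right herm_self smul_smul smul_of_real smul_scaleR_left)

lemma herm_proj_left: "\<langle>x, w\<rangle> = 0 \<Longrightarrow> \<langle>proj V x v, w\<rangle> = \<langle>v, w\<rangle>"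
  by (simp add: proj_eq herm_diff_left herm_scaleR_left herm_smul_left)

lemma proj_smul_base: "k \<noteq> 0 \<Longrightarrow> proj V (x \<cdot> k) v = proj V x v"
proof -
  assume k: "k \<noteq> 0"
  have "(x \<cdot> k) \<cdot> \<langle>x \<cdot> k, v\<rangle> = (norm k)\<^sup>2 *\<^sub>R (x \<cdot> \<langle>x, v\<rangle>)"
    by (simp add: herm_smul_left smul_smul[symmetric] mult.assoc[symmetric] times_conj_self
        smul_scaleR_right)
  then show ?thesis using k by (simp add: proj_eq qf_smul)
qed


subsection \<open>Lines\<close>

lemma line_smul: "k \<noteq> 0 \<Longrightarrow> line V (x \<cdot> k) = line V x"
proof -
  assume k: "k \<noteq> 0"
  have "x \<cdot> l = (x \<cdot> k) \<cdot> (inverse k * l)" for l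
    using k by (simp add: smul_smul[symmetric] mult.assoc[symmetric])
  then show ?thesis
    unfolding line_def by (auto simp: smul_smul[symmetric])
qed

lemma line_self: "x \<in> line V x"
  unfolding line_def by (rule range_eqI[of _ _ 1]) simp

lemma line_eqE:
  assumes "line V x = line V y" "y \<noteq> 0"
  obtains k where "k \<noteq> 0" "y = x \<cdot> k"
proof -
  have "y \<in> line V x" using assms(1) line_self by simp
  then obtain k where "y = x \<cdot> k" unfolding line_def by auto
  with assms(2) show ?thesis using that by (cases "k = 0") auto
qed

text \<open>The representative chosen by \<open>rep\<close> is unknown; below, every construction that uses it is
  invariant under multiplication by a nonzero scalar.\<close>

lemma rep_line:
  assumes "x \<noteq> 0"
  obtains k where "k \<noteq> 0" "rep (line V x) = x \<cdot> k"
proof -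
  have "rep (line V x) \<in> line V x \<and> rep (line V x) \<noteq> 0"
    unfolding rep_def by (rule someI[of _ x]) (simp add: line_self assms)
  then obtain k where "rep (line V x) = x \<cdot> k" "rep (line V x) \<noteq> 0"
    unfolding line_def by auto
  then show ?thesis using that by (cases "k = 0") auto
qed

lemma line_in_nonisotropic_points: "qf x \<noteq> 0 \<Longrightarrow> line V x \<in> nonisotropic_points V"
  by (auto simp: nonisotropic_points_def nonisotropic_iff)

lemma nonisotropic_pointsE:
  assumes "P \<in> nonisotropic_points V"
  obtains x where "qf x \<noteq> 0" "P = line V x"
  using assms by (auto simp: nonisotropic_points_def nonisotropic_iff)

lemma perp_line: "v \<in> perp V (line V x) \<longleftrightarrow> \<langle>x, v\<rangle> = 0"
proof -
  have "\<langle>x \<cdot> k, v\<rangle> = 0" if "\<langle>x, v\<rangle> = 0" for k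
    using that by (simp add: herm_smul_left)
  then show ?thesis
    unfolding perp_def line_def by (auto dest: spec[of _ 1])
qed


subsection \<open>Rank-one maps and tangent vectors\<close>

definition rank1 :: "'v \<Rightarrow> 'v \<Rightarrow> ('v \<Rightarrow>\<^sub>L 'v)" where
  "rank1 w x = Blinfun (\<lambda>v. w \<cdot> \<langle>x, v\<rangle>)"

lemma rank1_apply [simp]: "rank1 w x v = w \<cdot> \<langle>x, v\<rangle>"
  unfolding rank1_def
  by (subst bounded_linear_Blinfun_apply)
    (auto intro!: bounded_linear_compose[OF bounded_bilinear.bounded_linear_right[OF bounded_bilinear_smul]]
      bounded_bilinear.bounded_linear_right[OF bounded_bilinear_herm])

lemma bounded_bilinear_rank1: "bounded_bilinear rank1"
  unfolding bilinear_conv_bounded_bilinear[symmetric]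
  by (auto intro!: linearI blinfun_eqI simp: bilinear_def smul_add_left smul_add_right herm_add_left
      smul_scaleR_left smul_scaleR_right herm_scaleR_left blinfun.add_left blinfun.scaleR_left)

text \<open>The tangent vector at the point of \<open>x\<close> with value \<open>\<pi>[x] w\<close> at the representative \<open>x\<close>.
  Spread fields, velocities and covariant derivatives all have this form.\<close>

definition tvec :: "'v \<Rightarrow> 'v \<Rightarrow> ('v \<Rightarrow>\<^sub>L 'v)" where
  "tvec x w = Blinfun (\<lambda>v. proj V x w \<cdot> (\<langle>x, v\<rangle> / \<langle>x, x\<rangle>))"

lemma tvec_eq_rank1: "tvec x w = (1 / qf x) *\<^sub>R rank1 (proj V x w) x"
proof -
  have "(\<lambda>v. proj V x w \<cdot> (\<langle>x, v\<rangle> / \<langle>x, x\<rangle>)) = blinfun_apply ((1 / qf x) *\<^sub>R rank1 (proj V x w) x)"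
    by (rule ext) (simp add: herm_self divide_of_real smul_scaleR_right blinfun.scaleR_left)
  then show ?thesis by (simp add: tvec_def blinfun_apply_inverse)
qed

lemma tvec_apply: "tvec x w v = (1 / qf x) *\<^sub>R (proj V x w \<cdot> \<langle>x, v\<rangle>)"
  by (simp add: tvec_eq_rank1 blinfun.scaleR_left)

lemma tvec_self [simp]: "qf x \<noteq> 0 \<Longrightarrow> tvec x w x = proj V x w"
  by (simp add: tvec_apply herm_self smul_of_real)

lemma tvec_add: "tvec x (v + w) = tvec x v + tvec x w"
  by (rule blinfun_eqI) (simp add: tvec_apply proj_add smul_add_left blinfun.add_left scaleR_add_right)

lemma tvec_scaleR: "tvec x (r *\<^sub>R w) = r *\<^sub>R tvec x w"
  by (rule blinfun_eqI) (simp add: tvec_apply proj_scaleR smul_scaleR_left blinfun.scaleR_left)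

lemma tvec_eq_0: "proj V x w = 0 \<Longrightarrow> tvec x w = 0"
  by (rule blinfun_eqI) (simp add: tvec_apply)

lemma tvec_tangent: "qf x \<noteq> 0 \<Longrightarrow> tvec x w \<in> tangent_space V (line V x)"
  by (auto simp: tangent_space_def klinear_def perp_line tvec_apply herm_smul_right herm_proj
      herm_scaleR_right smul_smul smul_scaleR_left)

lemma tangent_herm:
  "t \<in> tangent_space V (line V x) \<Longrightarrow> \<langle>x, t x\<rangle> = 0"
  using line_self by (auto simp: tangent_space_def perp_line)

lemma tangent_klinear: "t \<in> tangent_space V P \<Longrightarrow> t (v \<cdot> k) = t v \<cdot> k"
  by (auto simp: tangent_space_def klinear_def)

lemma tangent_kernel: "t \<in> tangent_space V (line V x) \<Longrightarrow> \<langle>x, v\<rangle> = 0 \<Longrightarrow> t v = 0"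
  by (auto simp: tangent_space_def perp_line)

lemma tangent_eq_tvec:
  assumes "t \<in> tangent_space V (line V x)" "qf x \<noteq> 0"
  shows "t = tvec x (t x)"
proof (rule blinfun_eqI)
  fix v
  have "t v = t (proj V x v) + t ((1 / qf x) *\<^sub>R (x \<cdot> \<langle>x, v\<rangle>))"
    by (simp add: proj_eq blinfun.add_right[symmetric])
  also have "t (proj V x v) = 0"
    using tangent_kernel[OF assms(1)] herm_proj[OF assms(2)] by blast
  also have "t ((1 / qf x) *\<^sub>R (x \<cdot> \<langle>x, v\<rangle>)) = tvec x (t x) v"
    using tangent_herm[OF assms(1)]
    by (simp add: blinfun.scaleR_right tangent_klinear[OF assms(1)] tvec_apply)
  finally show "t v = tvec x (t x) v" by simp
qed

lemma tangent_eqI: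
  assumes "t \<in> tangent_space V (line V x)" "u \<in> tangent_space V (line V x)" "qf x \<noteq> 0" "t x = u x"
  shows "t = u"
  using tangent_eq_tvec[OF assms(1,3)] tangent_eq_tvec[OF assms(2,3)] assms(4) by simp

lemma tvec_smul: "k \<noteq> 0 \<Longrightarrow> tvec (x \<cdot> k) (w \<cdot> k) = tvec x w"
proof (rule blinfun_eqI)
  fix v
  assume k: "k \<noteq> 0"
  have "(u \<cdot> k) \<cdot> \<langle>x \<cdot> k, v\<rangle> = (norm k)\<^sup>2 *\<^sub>R (u \<cdot> \<langle>x, v\<rangle>)" for u
    by (simp add: herm_smul_left smul_smul[symmetric] mult.assoc[symmetric] times_conj_self
        smul_scaleR_right)
  then show "tvec (x \<cdot> k) (w \<cdot> k) v = tvec x w v"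
    using k by (simp add: tvec_apply proj_smul_base proj_smul qf_smul)
qed

lemma tvec_add_fibre: "qf x \<noteq> 0 \<Longrightarrow> tvec x (w + x \<cdot> k) = tvec x w"
  by (simp add: tvec_eq_rank1 proj_add proj_self)

lemma spread_eq_tvec:
  assumes "klinear V t"
  shows "spread V t x = tvec x (t x)"
proof -
  have "proj V x (t (proj' V x v)) = proj V x (t x) \<cdot> (\<langle>x, v\<rangle> / \<langle>x, x\<rangle>)" for v
    using assms by (simp add: proj'_def klinear_def proj_smul)
  then show ?thesis by (simp add: spread_def tvec_def)
qed

lemma velocity_eq_tvec: "velocity V \<gamma> s = tvec (\<gamma> s) (derivative_on_01 \<gamma> s)"
  by (simp add: velocity_def tvec_def)

lemma smooth_on_smul: "smooth_on S f \<Longrightarrow> smooth_on S g \<Longrightarrow> smooth_on S (\<lambda>x. f x \<cdot> g x)"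
  by (rule smooth_on_bilinear[OF bounded_bilinear_smul])

lemma smooth_on_herm: "smooth_on S f \<Longrightarrow> smooth_on S g \<Longrightarrow> smooth_on S (\<lambda>x. \<langle>f x, g x\<rangle>)"
  by (rule smooth_on_bilinear[OF bounded_bilinear_herm])

lemma smooth_on_qf: "smooth_on S f \<Longrightarrow> smooth_on S (\<lambda>x. qf (f x))"
  unfolding qf_def by (rule smooth_on_bilinear[OF bounded_bilinear_re_herm])

lemma smooth_on_tvec:
  assumes "smooth_on S f" "smooth_on S g" "\<And>x. x \<in> S \<Longrightarrow> qf (f x) \<noteq> 0"
  shows "smooth_on S (\<lambda>x. tvec (f x) (g x))"
  unfolding tvec_eq_rank1 proj_eq divide_inverse
  by (intro smooth_on_scaleR smooth_on_bilinear[OF bounded_bilinear_rank1] smooth_on_diff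
      smooth_on_mult smooth_on_inverse smooth_on_smul smooth_on_herm smooth_on_qf smooth_on_const
      assms) auto


subsection \<open>Metric and derivations\<close>

text \<open>Uniqueness of the adjoint comes from nondegeneracy of the form.\<close>

lemma adjoint'_tvec:
  assumes "\<langle>x, w\<rangle> = 0"
  shows "adjoint' V (tvec x w) = (1 / qf x) *\<^sub>R rank1 x w"
  unfolding adjoint'_def
proof (rule the_equality)
  show adj: "\<forall>v u. \<langle>tvec x w v, u\<rangle> = \<langle>v, ((1 / qf x) *\<^sub>R rank1 x w) u\<rangle>"
    using assms herm_conj[of x]
    by (simp add: tvec_apply herm_scaleR_left herm_scaleR_right herm_smul_left herm_smul_right
        blinfun.scaleR_left) (metis herm_conj)
  fix s
  assume *: "\<forall>v u. \<langle>tvec x w v, u\<rangle> = \<langle>v, blinfun_apply s u\<rangle>"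
  show "s = (1 / qf x) *\<^sub>R rank1 x w"
  proof (rule blinfun_eqI)
    fix u
    let ?d = "s u - ((1 / qf x) *\<^sub>R rank1 x w) u"
    have "\<langle>v, ?d\<rangle> = 0" for v
      using adj * unfolding herm_diff_right by (metis diff_self)
    then have "?d = 0"
      using herm_eq_0_commute by (intro herm_nondegenerate) blast
    then show "s u = ((1 / qf x) *\<^sub>R rank1 x w) u" by simp
  qed
qed

text \<open>The composition of the adjoint of \<open>t\<close> with \<open>u\<close> factors through the scalars. Its trace is therefore
  that of a left multiplication, and the factor \<open>DIM('k)\<close> cancels against the one in the metric.\<close>

lemma metric_eq:
  assumes "t \<in> tangent_space V (line V x)" "u \<in> tangent_space V (line V x)" "qf x \<noteq> 0"
  shows "metric V \<sigma> t u = \<sigma> * (re \<langle>t x, u x\<rangle> / qf x)"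
proof -
  let ?k = "\<langle>t x, u x\<rangle>"
  have t: "adjoint' V t = (1 / qf x) *\<^sub>R rank1 x (t x)"
    using adjoint'_tvec[OF tangent_herm[OF assms(1)]] tangent_eq_tvec[OF assms(1,3)] by simp
  have u: "u v = (1 / qf x) *\<^sub>R (u x \<cdot> \<langle>x, v\<rangle>)" for v
    using tangent_eq_tvec[OF assms(2,3)] tangent_herm[OF assms(2)]
    by (metis tvec_apply proj_orthogonal)
  have "(adjoint' V t o\<^sub>L u) v = (1 / (qf x * qf x)) *\<^sub>R (x \<cdot> (?k * \<langle>x, v\<rangle>))" for v
    by (simp add: t u[of v] blinfun.scaleR_left herm_scaleR_right herm_smul_right smul_scaleR_right)
  then have "real_trace (adjoint' V t o\<^sub>L u)
      = (1 / (qf x * qf x)) * (\<Sum>b\<in>Basis. (x \<cdot> (?k * \<langle>x, b\<rangle>)) \<bullet> b)"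
    by (simp add: real_trace_def sum_distrib_left)
  also have "(\<Sum>b\<in>Basis. (x \<cdot> (?k * \<langle>x, b\<rangle>)) \<bullet> b) = (\<Sum>c\<in>Basis. (?k * \<langle>x, x \<cdot> c\<rangle>) \<bullet> c)"
    by (rule trace_comp_commute[of "\<lambda>c. x \<cdot> c" "\<lambda>v. ?k * \<langle>x, v\<rangle>"])
      (auto intro!: linearI simp: smul_add_right smul_scaleR_right herm_add_right herm_scaleR_right
        algebra_simps)
  also have "\<dots> = qf x * (\<Sum>c\<in>Basis. (?k * c) \<bullet> c)"
    by (simp add: herm_smul_right herm_self of_real_def sum_distrib_left)
  also have "\<dots> = qf x * (DIM('k) * re ?k)"
    by (simp only: trace_left_mult)
  finally show ?thesis
    using assms(3) by (simp add: metric_def)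
qed

lemma derivation_line:
  assumes "klinear V t" "x \<noteq> 0"
  shows "derivation V (line V x) t f = deriv (\<lambda>\<epsilon>. f (line V (x + \<epsilon> *\<^sub>R t x))) 0"
proof -
  obtain k where k: "k \<noteq> 0" "rep (line V x) = x \<cdot> k"
    using rep_line[OF assms(2)] .
  have "rep (line V x) + \<epsilon> *\<^sub>R t (rep (line V x)) = (x + \<epsilon> *\<^sub>R t x) \<cdot> k" for \<epsilon>
    using assms(1) by (simp add: k klinear_def smul_add_left smul_scaleR_left)
  then show ?thesis
    by (simp add: derivation_def line_smul[OF k(1)])
qed

text \<open>The nonisotropic vectors form an open set, so it suffices to know \<open>f\<close> on their lines.\<close>

lemma derivation_eq:
  assumes t: "t \<in> tangent_space V (line V x)" and x: "qf x \<noteq> 0"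
    and F: "(F has_derivative F') (at x)" and f: "\<And>z. qf z \<noteq> 0 \<Longrightarrow> f (line V z) = F z"
  shows "derivation V (line V x) t f = F' (t x)"
proof -
  have "((\<lambda>\<epsilon>. x + \<epsilon> *\<^sub>R t x) has_derivative (\<lambda>\<epsilon>. \<epsilon> *\<^sub>R t x)) (at 0)"
    by (auto intro!: derivative_eq_intros)
  moreover have "((\<lambda>z. f (line V z)) has_derivative F') (at x)"
    by (rule has_derivative_transform_within_open[OF F open_nonisotropic])
      (use x f in \<open>auto simp: nonisotropic_iff\<close>)
  ultimately have "((\<lambda>\<epsilon>. f (line V (x + \<epsilon> *\<^sub>R t x))) has_derivative (\<lambda>\<epsilon>. F' (\<epsilon> *\<^sub>R t x))) (at 0)"
    using has_derivative_compose[of "\<lambda>\<epsilon>. x + \<epsilon> *\<^sub>R t x" _ 0 UNIV "\<lambda>z. f (line V z)" F'] by simp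
  moreover have "(\<lambda>\<epsilon>. F' (\<epsilon> *\<^sub>R t x)) = (*) (F' (t x))"
    using linear_scale[OF has_derivative_linear[OF F]] by (auto simp: mult.commute)
  ultimately have "((\<lambda>\<epsilon>. f (line V (x + \<epsilon> *\<^sub>R t x))) has_real_derivative F' (t x)) (at 0)"
    by (simp add: has_field_derivative_def)
  then show ?thesis
    using derivation_line t x by (simp add: DERIV_imp_deriv tangent_space_def qf_nonzero_imp)
qed

end


section \<open>The Levi-Civita connection\<close>

context hermitian_space
begin

lemma tangent_diff:
  "t \<in> tangent_space V P \<Longrightarrow> u \<in> tangent_space V P \<Longrightarrow> t - u \<in> tangent_space V P"
  by (auto simp: tangent_space_def klinear_def perp_def blinfun.diff_left smul_diff_left
      herm_diff_right)

lemma tangent_lincomb: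
  "t \<in> tangent_space V P \<Longrightarrow> u \<in> tangent_space V P \<Longrightarrow> a *\<^sub>R t + b *\<^sub>R u \<in> tangent_space V P"
  by (auto simp: tangent_space_def klinear_def perp_def blinfun.add_left blinfun.scaleR_left
      smul_add_left smul_scaleR_left herm_add_right herm_scaleR_right)

lemma smooth_field_tangent: "smooth_field V Y \<Longrightarrow> qf x \<noteq> 0 \<Longrightarrow> Y (line V x) \<in> tangent_space V (line V x)"
  by (auto simp: smooth_field_def line_in_nonisotropic_points)

abbreviation lift_derivative :: "('v set \<Rightarrow> ('v \<Rightarrow>\<^sub>L 'v)) \<Rightarrow> 'v \<Rightarrow> 'v \<Rightarrow> ('v \<Rightarrow>\<^sub>L 'v)" where
  "lift_derivative Y x \<equiv> frechet_derivative (\<lambda>z. Y (line V z)) (at x)"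

lemma smooth_field_has_derivative:
  assumes "smooth_field V Y" "qf x \<noteq> 0"
  shows "((\<lambda>z. Y (line V z)) has_derivative lift_derivative Y x) (at x)"
  using assms smooth_on_open_has_derivative[OF open_nonisotropic]
  by (auto simp: smooth_field_def nonisotropic_iff)

lemma field_value_has_derivative:
  assumes "smooth_field V Y" "qf x \<noteq> 0"
  shows "((\<lambda>z. Y (line V z) z) has_derivative
    (\<lambda>u. Y (line V x) u + lift_derivative Y x u x)) (at x)"
  by (rule bounded_bilinear.FDERIV[OF bounded_bilinear_blinfun_apply
        smooth_field_has_derivative[OF assms] has_derivative_ident])

text \<open>Differentiate the identity \<open>\<langle>z, Y(z) z\<rangle> = 0\<close> in a direction \<open>u\<close> orthogonal to \<open>x\<close>, where
  \<open>Y(x) u = 0\<close>.\<close>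

lemma herm_lift_derivative:
  assumes Y: "smooth_field V Y" and x: "qf x \<noteq> 0" and u: "\<langle>x, u\<rangle> = 0"
  shows "\<langle>x, lift_derivative Y x u x\<rangle> = - \<langle>u, Y (line V x) x\<rangle>"
proof -
  note d = bounded_bilinear.FDERIV[OF bounded_bilinear_herm has_derivative_ident
      field_value_has_derivative[OF Y x]]
  have "((\<lambda>z. 0) has_derivative (\<lambda>u. \<langle>x, Y (line V x) u + lift_derivative Y x u x\<rangle>
      + \<langle>u, Y (line V x) x\<rangle>)) (at x)"
    by (rule has_derivative_transform_within_open[OF d open_nonisotropic])
      (use x tangent_herm[OF smooth_field_tangent[OF Y]] in \<open>auto simp: nonisotropic_iff\<close>)
  then have "(\<lambda>u. \<langle>x, Y (line V x) u + lift_derivative Y x u x\<rangle> + \<langle>u, Y (line V x) x\<rangle>) = (\<lambda>u. 0)"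
    using has_derivative_const has_derivative_unique by blast
  from fun_cong[OF this, of u] show ?thesis
    using tangent_kernel[OF smooth_field_tangent[OF Y x] u] by (simp add: add_eq_0_iff2)
qed

text \<open>The field spread from \<open>B\<close> as a function on points. Such fields extend a given tangent vector to a
  global smooth field, and their restrictions to a curve span all fields along it.\<close>

definition spread_field :: "('v \<Rightarrow>\<^sub>L 'v) \<Rightarrow> 'v set \<Rightarrow> ('v \<Rightarrow>\<^sub>L 'v)" where
  "spread_field B P = tvec (rep P) (B (rep P))"

lemma spread_field_line:
  assumes "klinear V B" "qf x \<noteq> 0"
  shows "spread_field B (line V x) = tvec x (B x)"
proof -
  obtain k where "k \<noteq> 0" "rep (line V x) = x \<cdot> k"
    using rep_line qf_nonzero_imp[OF assms(2)] by blast
  then show ?thesis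
    using assms(1) by (simp add: spread_field_def klinear_def tvec_smul)
qed

lemma smooth_field_spread_field:
  assumes "klinear V B"
  shows "smooth_field V (spread_field B)"
  unfolding smooth_field_def
proof
  show "\<forall>P\<in>nonisotropic_points V. spread_field B P \<in> tangent_space V P"
    by (auto elim!: nonisotropic_pointsE simp: spread_field_line[OF assms] tvec_tangent)
  have "smooth_on {x. nonisotropic V x} (\<lambda>x. tvec x (B x))"
    by (intro smooth_on_tvec smooth_on_blinfun_apply smooth_on_const smooth_on_ident)
      (simp add: nonisotropic_iff)
  then show "smooth_on {x. nonisotropic V x} (\<lambda>x. spread_field B (line V x))"
    by (rule smooth_on_cong) (simp add: nonisotropic_iff spread_field_line[OF assms])
qed

lemma spread_field_extends:
  assumes "t \<in> tangent_space V (line V x)" "qf x \<noteq> 0"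
  shows "spread_field t (line V x) = t"
  using spread_field_line[of t x] tangent_eq_tvec[OF assms] assms
  by (simp add: tangent_space_def)

text \<open>The flat derivative of lifts is compatible with the metric: at \<open>x\<close> the derivative of
  \<open>\<langle>z, z\<rangle>\<close> in directions orthogonal to \<open>x\<close> vanishes, and so do the values of tangent vectors
  on these directions.\<close>

lemma derivation_metric:
  assumes Y: "smooth_field V Y" and Z: "smooth_field V Z" and x: "qf x \<noteq> 0"
    and t: "t \<in> tangent_space V (line V x)"
  shows "derivation V (line V x) t (\<lambda>Q. metric V \<sigma> (Y Q) (Z Q))
    = \<sigma> * ((re \<langle>lift_derivative Y x (t x) x, Z (line V x) x\<rangle>
          + re \<langle>Y (line V x) x, lift_derivative Z x (t x) x\<rangle>) / qf x)"
proof -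
  let ?N = "\<lambda>z. re \<langle>Y (line V z) z, Z (line V z) z\<rangle>"
  note N = bounded_bilinear.FDERIV[OF bounded_bilinear_re_herm
      field_value_has_derivative[OF Y x] field_value_has_derivative[OF Z x]]
  note F = has_derivative_mult_right[OF has_derivative_divide'[OF N has_derivative_qf x], of \<sigma>]
  have "metric V \<sigma> (Y (line V z)) (Z (line V z)) = \<sigma> * (?N z / qf z)" if "qf z \<noteq> 0" for z
    by (rule metric_eq[OF smooth_field_tangent[OF Y that] smooth_field_tangent[OF Z that] that])
  from derivation_eq[OF t x F this] show ?thesis
    using x tangent_herm[OF t] tangent_kernel[OF smooth_field_tangent[OF Y x] tangent_herm[OF t]]
      tangent_kernel[OF smooth_field_tangent[OF Z x] tangent_herm[OF t]]
    by (simp add: add.commute)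
qed

text \<open>The derivative of this function at \<open>x\<close> along a tangent vector \<open>t\<close> is \<open>re \<langle>a, t x\<rangle>\<close>. With
  \<open>a\<close> arbitrary, these functions therefore separate the tangent vectors at \<open>x\<close>.\<close>

definition test_function :: "'v \<Rightarrow> 'v \<Rightarrow> 'v set \<Rightarrow> real" where
  "test_function a x P = re (\<langle>a, rep P\<rangle> * \<langle>rep P, x\<rangle>) / qf (rep P)"

lemma test_function_line:
  assumes "qf z \<noteq> 0"
  shows "test_function a x (line V z) = re (\<langle>a, z\<rangle> * \<langle>z, x\<rangle>) / qf z"
proof -
  obtain k where k: "k \<noteq> 0" "rep (line V z) = z \<cdot> k"
    using rep_line qf_nonzero_imp[OF assms] by blast
  have "\<langle>a, z \<cdot> k\<rangle> * \<langle>z \<cdot> k, x\<rangle> = \<langle>a, z\<rangle> * ((k * conj k) * \<langle>z, x\<rangle>)"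
    by (simp only: herm_smul_left herm_smul_right mult.assoc)
  also have "\<dots> = (norm k)\<^sup>2 *\<^sub>R (\<langle>a, z\<rangle> * \<langle>z, x\<rangle>)"
    by (simp add: times_conj_self)
  finally show ?thesis
    using k by (simp add: test_function_def qf_smul re_scaleR)
qed

abbreviation test_form :: "'v \<Rightarrow> 'v \<Rightarrow> 'v \<Rightarrow> 'v \<Rightarrow> real" where
  "test_form a x z w \<equiv> re (\<langle>a, z\<rangle> * \<langle>w, x\<rangle>)"

lemma bounded_bilinear_test_form: "bounded_bilinear (test_form a x)"
  unfolding bilinear_conv_bounded_bilinear[symmetric]
  by (auto intro!: linearI simp: bilinear_def herm_add_left herm_add_right herm_scaleR_left
      herm_scaleR_right re_add re_scaleR algebra_simps)

lemma smooth_function_test_function: "smooth_function V (test_function a x)"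
proof -
  have "smooth_on {z. nonisotropic V z} (\<lambda>z. test_form a x z z * inverse (qf z))"
    by (intro smooth_on_mult smooth_on_bilinear[OF bounded_bilinear_test_form] smooth_on_ident
        smooth_on_inverse smooth_on_qf) (simp add: nonisotropic_iff)
  then show ?thesis
    unfolding smooth_function_def
    by (rule smooth_on_cong) (simp add: test_function_line nonisotropic_iff divide_inverse)
qed

lemma derivation_test_function:
  assumes t: "t \<in> tangent_space V (line V z)" and z: "qf z \<noteq> 0"
  shows "derivation V (line V z) t (test_function a x)
    = (test_form a x z (t z) + test_form a x (t z) z) / qf z"
proof -
  note F = has_derivative_divide'[OF bounded_bilinear.FDERIV[OF bounded_bilinear_test_form[of a x]
        has_derivative_ident has_derivative_ident] has_derivative_qf z]
  from derivation_eq[OF t z F test_function_line] show ?thesis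
    using z tangent_herm[OF t] by simp
qed

text \<open>Because the field is orthogonal to the position vector, the first derivative of the test
  function along it is a symmetric form divided by \<open>\<langle>z, z\<rangle>\<close>, and differentiating once more
  requires no second derivatives of quotients.\<close>

lemma derivation_derivation_test_function:
  assumes Y: "smooth_field V Y" and t: "t \<in> tangent_space V (line V x)" and x: "qf x \<noteq> 0"
  shows "derivation V (line V x) t (\<lambda>Q. derivation V Q (Y Q) (test_function a b))
    = (test_form a b (t x) (Y (line V x) x) + test_form a b (Y (line V x) x) (t x)
      + test_form a b x (lift_derivative Y x (t x) x)
      + test_form a b (lift_derivative Y x (t x) x) x) / qf x"
proof -
  note y = field_value_has_derivative[OF Y x]
  note F = has_derivative_divide'[OF has_derivative_add[OF
        bounded_bilinear.FDERIV[OF bounded_bilinear_test_form[of a b] has_derivative_ident y]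
        bounded_bilinear.FDERIV[OF bounded_bilinear_test_form[of a b] y has_derivative_ident]]
        has_derivative_qf x]
  from derivation_eq[OF t x F derivation_test_function[OF smooth_field_tangent[OF Y]]] show ?thesis
    using x tangent_herm[OF t] tangent_kernel[OF smooth_field_tangent[OF Y x] tangent_herm[OF t]]
    by (simp add: add_ac)
qed

end

locale hermitian_levi_civita = hermitian_space V + levi_civita V \<sigma> nabla
  for V :: "('k::rch, 'v::euclidean_space) hspace" (structure) and \<sigma> and nabla ("\<nabla>") +
  assumes sign: "\<sigma> \<noteq> 0"
begin

text \<open>The value at \<open>x\<close> of the difference between the given connection and the projected flat
  derivative.\<close>

definition deviation :: "'v \<Rightarrow> ('v \<Rightarrow>\<^sub>L 'v) \<Rightarrow> ('v set \<Rightarrow> ('v \<Rightarrow>\<^sub>L 'v)) \<Rightarrow> 'v" where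
  "deviation x t Y = \<nabla> (line V x) t Y x - proj V x (lift_derivative Y x (t x) x)"

lemma deviation_orthogonal:
  assumes "t \<in> tangent_space V (line V x)" "smooth_field V Y" "qf x \<noteq> 0"
  shows "\<langle>x, deviation x t Y\<rangle> = 0"
  using tangent_herm[OF tangent[OF line_in_nonisotropic_points[OF assms(3)] assms(1,2)]] assms(3)
  by (simp add: deviation_def herm_diff_right herm_proj)

text \<open>Both terms of the deviation are compatible with the metric.\<close>

lemma deviation_skew:
  assumes x: "qf x \<noteq> 0" and t: "t \<in> tangent_space V (line V x)"
    and Y: "smooth_field V Y" and Z: "smooth_field V Z"
  shows "re \<langle>deviation x t Y, Z (line V x) x\<rangle> = - re \<langle>deviation x t Z, Y (line V x) x\<rangle>"
proof -
  note P = line_in_nonisotropic_points[OF x]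
  note Yx = smooth_field_tangent[OF Y x] and Zx = smooth_field_tangent[OF Z x]
  have "derivation V (line V x) t (\<lambda>Q. metric V \<sigma> (Y Q) (Z Q))
      = \<sigma> * (re \<langle>\<nabla> (line V x) t Y x, Z (line V x) x\<rangle> / qf x)
        + \<sigma> * (re \<langle>Y (line V x) x, \<nabla> (line V x) t Z x\<rangle> / qf x)"
    by (simp only: metric_compatible[OF P t Y Z] metric_eq[OF tangent[OF P t Y] Zx x]
        metric_eq[OF Yx tangent[OF P t Z] x])
  then have "\<sigma> * ((re \<langle>lift_derivative Y x (t x) x, Z (line V x) x\<rangle>
        + re \<langle>Y (line V x) x, lift_derivative Z x (t x) x\<rangle>) / qf x)
      = \<sigma> * ((re \<langle>\<nabla> (line V x) t Y x, Z (line V x) x\<rangle>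
        + re \<langle>Y (line V x) x, \<nabla> (line V x) t Z x\<rangle>) / qf x)"
    by (simp only: derivation_metric[OF Y Z x t] add_divide_distrib ring_distribs)
  then have "re \<langle>lift_derivative Y x (t x) x, Z (line V x) x\<rangle>
        + re \<langle>lift_derivative Z x (t x) x, Y (line V x) x\<rangle>
      = re \<langle>\<nabla> (line V x) t Y x, Z (line V x) x\<rangle> + re \<langle>\<nabla> (line V x) t Z x, Y (line V x) x\<rangle>"
    using x sign re_herm_commute by simp
  then show ?thesis
    by (simp add: deviation_def herm_diff_left re_diff herm_proj_left tangent_herm[OF Yx]
        tangent_herm[OF Zx])
qed

text \<open>The bracket of the two fields, applied to the test functions, is computed once from the projected
  derivatives and once, by torsion-freeness, from the given connection.\<close>

lemma deviation_symmetric: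
  assumes x: "qf x \<noteq> 0" and X: "smooth_field V X" and Y: "smooth_field V Y"
  shows "deviation x (X (line V x)) Y = deviation x (Y (line V x)) X"
proof -
  note P = line_in_nonisotropic_points[OF x]
  note Xx = smooth_field_tangent[OF X x] and Yx = smooth_field_tangent[OF Y x]
  define u v where "u = X (line V x) x" and "v = Y (line V x) x"
  define d where "d = lift_derivative Y x u x - lift_derivative X x v x"
  define t where "t = \<nabla> (line V x) (X (line V x)) Y - \<nabla> (line V x) (Y (line V x)) X"
  have t: "t \<in> tangent_space V (line V x)"
    unfolding t_def by (intro tangent_diff tangent P Xx Yx X Y)
  \<comment> \<open>The derivative \<open>d\<close> need not be orthogonal to \<open>x\<close>, but \<open>\<langle>x, d\<rangle>\<close> is purely imaginary, so that
    its component along \<open>x\<close> contributes nothing to the real parts below.\<close>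
  have xd: "\<langle>x, d\<rangle> = \<langle>v, u\<rangle> - \<langle>u, v\<rangle>"
    using herm_lift_derivative[OF Y x tangent_herm[OF Xx]]
      herm_lift_derivative[OF X x tangent_herm[OF Yx]]
    by (simp add: d_def herm_diff_right u_def v_def)
  have "\<langle>d, x\<rangle> = conj \<langle>x, d\<rangle>"
    by (rule herm_conj)
  also have "\<dots> = \<langle>u, v\<rangle> - \<langle>v, u\<rangle>"
    unfolding xd conj_diff by (simp only: herm_conj[symmetric])
  finally have skew: "\<langle>d, x\<rangle> = - \<langle>x, d\<rangle>"
    by (simp add: xd)
  have "re \<langle>t x - proj V x d, a\<rangle> = 0" for a
  proof -
    have "derivation V (line V x) t (test_function a x)
        = (test_form a x x d + test_form a x d x) / qf x"
      using torsion_free[OF P X Y smooth_function_test_function[of a x], folded t_def]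
      unfolding derivation_derivation_test_function[OF Y Xx x]
        derivation_derivation_test_function[OF X Yx x] u_def[symmetric] v_def[symmetric]
      by (simp add: d_def herm_diff_left herm_diff_right re_diff left_diff_distrib
          right_diff_distrib diff_divide_distrib add_divide_distrib)
    then have "test_form a x x (t x) + test_form a x (t x) x = test_form a x x d + test_form a x d x"
      using x by (simp add: derivation_test_function[OF t x])
    moreover have "\<langle>t x, x\<rangle> = 0"
      using tangent_herm[OF t] herm_eq_0_commute by blast
    ultimately have "qf x * re \<langle>a, t x\<rangle> = qf x * re \<langle>a, d\<rangle> - re (\<langle>a, x\<rangle> * \<langle>x, d\<rangle>)"
      by (simp add: skew herm_self re_minus) (simp add: of_real_def re_scaleR)
    then have "re \<langle>a, t x\<rangle> = re \<langle>a, proj V x d\<rangle>"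
      using x by (simp add: proj_eq herm_diff_right herm_scaleR_right herm_smul_right re_diff
          re_scaleR field_simps)
    then show ?thesis
      by (simp add: herm_diff_left re_diff re_herm_commute[of _ a])
  qed
  then have "t x = proj V x d"
    using re_herm_nondegenerate[of "t x - proj V x d"] by simp
  then show ?thesis
    by (simp add: deviation_def t_def d_def blinfun.diff_left proj_diff u_def v_def algebra_simps)
qed

text \<open>A trilinear expression that is symmetric in the first two and skew in the last two arguments
  vanishes.\<close>

lemma deviation_eq_0:
  assumes x: "qf x \<noteq> 0" and t: "t \<in> tangent_space V (line V x)" and Y: "smooth_field V Y"
  shows "deviation x t Y = 0"
proof (rule re_herm_nondegenerate)
  fix w
  have kl: "klinear V t" "klinear V (tvec x w)"
    using t tvec_tangent[OF x, of w] by (auto simp: tangent_space_def)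
  define X Z where "X = spread_field t" and "Z = spread_field (tvec x w)"
  have X: "smooth_field V X" "X (line V x) = t"
    unfolding X_def using kl t x by (auto intro: smooth_field_spread_field spread_field_extends)
  have Z: "smooth_field V Z" "Z (line V x) = tvec x w"
    unfolding Z_def using kl tvec_tangent[OF x] x
    by (auto intro: smooth_field_spread_field spread_field_extends)
  define c where "c A B C = re \<langle>deviation x (A (line V x)) B, C (line V x) x\<rangle>"
    for A B C :: "'v set \<Rightarrow> ('v \<Rightarrow>\<^sub>L 'v)"
  have skew: "c A B C = - c A C B" if "smooth_field V A" "smooth_field V B" "smooth_field V C" for A B C
    unfolding c_def using deviation_skew[OF x smooth_field_tangent[OF that(1) x] that(2,3)] .
  have sym: "c A B C = c B A C" if "smooth_field V A" "smooth_field V B" for A B C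
    unfolding c_def using deviation_symmetric[OF x that] by simp
  have "c X Y Z = - c X Z Y" using skew X(1) Y Z(1) .
  also have "\<dots> = - c Z X Y" using sym[OF X(1) Z(1)] by simp
  also have "\<dots> = c Z Y X" using skew[OF Z(1) X(1) Y] by simp
  also have "\<dots> = c Y Z X" using sym[OF Z(1) Y] .
  also have "\<dots> = - c Y X Z" using skew[OF Y Z(1) X(1)] .
  also have "\<dots> = - c X Y Z" using sym[OF X(1) Y] by simp
  finally have "c X Y Z = - c X Y Z" .
  then have "re \<langle>deviation x t Y, proj V x w\<rangle> = 0"
    using X(2) Z(2) x by (simp add: c_def)
  then show "re \<langle>deviation x t Y, w\<rangle> = 0"
    using herm_proj_left[OF deviation_orthogonal[OF t Y x]] by (metis re_herm_commute)
qed

text \<open>The Levi-Civita connection is the flat derivative of the lift, projected to the tangent space.\<close>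

lemma nabla_eq:
  assumes x: "qf x \<noteq> 0" and t: "t \<in> tangent_space V (line V x)" and Y: "smooth_field V Y"
  shows "\<nabla> (line V x) t Y = tvec x (lift_derivative Y x (t x) x)"
proof (rule tangent_eqI[OF tangent[OF line_in_nonisotropic_points[OF x] t Y] tvec_tangent[OF x] x])
  show "\<nabla> (line V x) t Y x = tvec x (lift_derivative Y x (t x) x) x"
    using deviation_eq_0[OF x t Y] x by (simp add: deviation_def)
qed

end


section \<open>Covariant derivative along a curve\<close>

text \<open>Gronwall's argument: the function \<open>exp (- 2 C s) \<bar>w\<bar>\<^sup>2\<close> cannot increase.\<close>

lemma linear_growth_zero:
  fixes w :: "real \<Rightarrow> 'a::real_inner"
  assumes w: "\<And>s. s \<in> {0..1} \<Longrightarrow> (w has_vector_derivative w' s) (at s within {0..1})"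
    and le: "\<And>s. s \<in> {0..1} \<Longrightarrow> norm (w' s) \<le> C * norm (w s)"
    and "w 0 = 0"
  shows "w 1 = 0"
proof -
  define g where "g s = exp (- 2 * C * s) * (w s \<bullet> w s)" for s
  define g' where "g' s = exp (- 2 * C * s) * (2 * (w s \<bullet> w' s) - 2 * C * (w s \<bullet> w s))" for s
  have d: "(g has_derivative (\<lambda>h. h * g' s)) (at s within {0..1})" if "s \<in> {0..1}" for s
    unfolding g_def[abs_def] g'_def
    using w[OF that] unfolding has_vector_derivative_def
    by (auto intro!: derivative_eq_intros ext simp: inner_commute algebra_simps)
  have "\<exists>x\<in>{0<..<1}. g 1 - g 0 = (1 - 0) * g' x"
    by (rule mvt_simple[OF _ d]) auto
  then obtain x where x: "x \<in> {0<..<1}" "g 1 - g 0 = g' x" by auto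
  have "w x \<bullet> w' x \<le> norm (w x) * norm (w' x)"
    by (rule norm_cauchy_schwarz)
  also have "\<dots> \<le> norm (w x) * (C * norm (w x))"
    using le[of x] x(1) by (intro mult_left_mono) auto
  also have "\<dots> = C * (w x \<bullet> w x)"
    by (simp add: dot_square_norm power2_eq_square)
  finally have "g' x \<le> 0"
    by (simp add: g'_def mult_nonneg_nonpos)
  then have "g 1 \<le> 0"
    using x(2) assms(3) by (simp add: g_def)
  then show ?thesis
    by (simp add: g_def mult_le_0_iff flip: power2_norm_eq_inner)
qed

context hermitian_space
begin

text \<open>The lift is constant on the fibre: \<open>x + \<epsilon> (x \<cdot> k) = x \<cdot> (1 + \<epsilon> k)\<close> spans the line of \<open>x\<close> as long
  as \<open>\<bar>\<epsilon>\<bar> \<bar>k\<bar> < 1\<close>.\<close>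

lemma lift_derivative_fibre:
  assumes "smooth_field V Z" "qf x \<noteq> 0"
  shows "lift_derivative Z x (x \<cdot> k) = 0"
proof -
  define d where "d = 1 / (norm k + 1)"
  have d: "d > 0" by (simp add: d_def add_nonneg_pos)
  have l: "((\<lambda>\<epsilon>. x + \<epsilon> *\<^sub>R (x \<cdot> k)) has_derivative (\<lambda>\<epsilon>. \<epsilon> *\<^sub>R (x \<cdot> k))) (at 0)"
    by (auto intro!: derivative_eq_intros)
  have F: "((\<lambda>\<epsilon>. Z (line V (x + \<epsilon> *\<^sub>R (x \<cdot> k)))) has_derivative
      (\<lambda>\<epsilon>. lift_derivative Z x (\<epsilon> *\<^sub>R (x \<cdot> k)))) (at 0)"
    using has_derivative_compose[OF l, of "\<lambda>z. Z (line V z)" "lift_derivative Z x"]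
      smooth_field_has_derivative[OF assms] by simp
  have "Z (line V (x + \<epsilon> *\<^sub>R (x \<cdot> k))) = Z (line V x)" if "\<epsilon> \<in> ball 0 d" for \<epsilon>
  proof -
    have "\<bar>\<epsilon>\<bar> * norm k < 1"
    proof -
      have "\<bar>\<epsilon>\<bar> * norm k \<le> \<bar>\<epsilon>\<bar> * (norm k + 1)" by (simp add: distrib_left)
      also have "\<dots> < 1"
        using that by (simp add: d_def add_nonneg_pos pos_less_divide_eq)
      finally show ?thesis .
    qed
    then have "1 + \<epsilon> *\<^sub>R k \<noteq> 0"
      by (metis add_eq_0_iff less_irrefl norm_minus_cancel norm_one norm_scaleR)
    moreover have "x + \<epsilon> *\<^sub>R (x \<cdot> k) = x \<cdot> (1 + \<epsilon> *\<^sub>R k)"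
      by (simp add: smul_add_right smul_scaleR_right)
    ultimately show ?thesis by (simp add: line_smul)
  qed
  then have "((\<lambda>\<epsilon>. Z (line V x)) has_derivative (\<lambda>\<epsilon>. lift_derivative Z x (\<epsilon> *\<^sub>R (x \<cdot> k)))) (at 0)"
    using d by (intro has_derivative_transform_within_open[OF F open_ball[of 0 d]]) auto
  then have "(\<lambda>\<epsilon>. lift_derivative Z x (\<epsilon> *\<^sub>R (x \<cdot> k))) = (\<lambda>\<epsilon>. 0)"
    using has_derivative_const has_derivative_unique by blast
  from fun_cong[OF this, of 1] show ?thesis by simp
qed

lemma lift_derivative_proj:
  assumes "smooth_field V Z" "qf x \<noteq> 0"
  shows "lift_derivative Z x (proj V x u) = lift_derivative Z x u"
  using lift_derivative_fibre[OF assms, of "\<langle>x, u\<rangle>"]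
    linear_diff[OF has_derivative_linear[OF smooth_field_has_derivative[OF assms]]]
    linear_scale[OF has_derivative_linear[OF smooth_field_has_derivative[OF assms]]]
  by (simp add: proj_eq)

lemma klinear_rank1: "klinear V (rank1 w x)"
  by (simp add: klinear_def herm_smul_right smul_smul)

lemma tvec_sum: "tvec x (\<Sum>i\<in>I. w i) = (\<Sum>i\<in>I. tvec x (w i))"
  by (induction I rule: infinite_finite_induct) (auto simp: tvec_add tvec_eq_0 proj_eq)

end

locale nonisotropic_curve = hermitian_levi_civita V \<sigma> nabla
  for V :: "('k::rch, 'v::euclidean_space) hspace" (structure) and \<sigma> and nabla ("\<nabla>") +
  fixes \<gamma> :: "real \<Rightarrow> 'v"
  assumes smooth_curve: "smooth_on {0..1} \<gamma>"
    and nonisotropic_curve: "\<And>s. s \<in> {0..1} \<Longrightarrow> qf (\<gamma> s) \<noteq> 0"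
begin

text \<open>The ordinary derivative, projected to the tangent space.\<close>

definition covD :: "(real \<Rightarrow> ('v \<Rightarrow>\<^sub>L 'v)) \<Rightarrow> real \<Rightarrow> ('v \<Rightarrow>\<^sub>L 'v)" where
  "covD X s = tvec (\<gamma> s) (derivative_on_01 X s (\<gamma> s))"

lemma field_along_smooth: "field_along V \<gamma> X \<Longrightarrow> smooth_on {0..1} X"
  and field_along_tangent:
    "field_along V \<gamma> X \<Longrightarrow> s \<in> {0..1} \<Longrightarrow> X s \<in> tangent_space V (line V (\<gamma> s))"
  by (auto simp: field_along_def)

lemma field_along_derivative:
  "field_along V \<gamma> X \<Longrightarrow> s \<in> {0..1} \<Longrightarrow>
    (X has_vector_derivative derivative_on_01 X s) (at s within {0..1})"
  by (intro smooth_on_01_has_vector_derivative field_along_smooth)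

lemma field_along_tvec:
  "smooth_on {0..1} w \<Longrightarrow> field_along V \<gamma> (\<lambda>s. tvec (\<gamma> s) (w s))"
  unfolding field_along_def
  using nonisotropic_curve smooth_curve by (auto intro: smooth_on_tvec tvec_tangent)

lemma field_along_cong:
  "field_along V \<gamma> X \<Longrightarrow> (\<And>s. s \<in> {0..1} \<Longrightarrow> X s = Y s) \<Longrightarrow> field_along V \<gamma> Y"
  unfolding field_along_def by (auto intro: smooth_on_cong)

lemma field_along_eq_tvec:
  "field_along V \<gamma> X \<Longrightarrow> s \<in> {0..1} \<Longrightarrow> tvec (\<gamma> s) (X s (\<gamma> s)) = X s"
  using tangent_eq_tvec[OF field_along_tangent nonisotropic_curve] by metis

lemma field_along_add:
  "field_along V \<gamma> X \<Longrightarrow> field_along V \<gamma> Y \<Longrightarrow> field_along V \<gamma> (\<lambda>s. X s + Y s)"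
  unfolding field_along_def using tangent_lincomb[of _ _ _ 1 1] by (auto intro: smooth_on_add)

lemma field_along_scaleR:
  "field_along V \<gamma> X \<Longrightarrow> smooth_on {0..1} f \<Longrightarrow> field_along V \<gamma> (\<lambda>s. f s *\<^sub>R X s)"
  unfolding field_along_def using tangent_lincomb[of _ _ _ _ 0] by (auto intro: smooth_on_scaleR)

lemma field_along_diff:
  "field_along V \<gamma> X \<Longrightarrow> field_along V \<gamma> Y \<Longrightarrow> field_along V \<gamma> (\<lambda>s. X s - Y s)"
  unfolding field_along_def using tangent_diff by (auto intro: smooth_on_diff)

lemma field_along_zero: "field_along V \<gamma> (\<lambda>s. 0)"
  using field_along_scaleR[OF field_along_tvec[OF smooth_on_const[of _ 0]] smooth_on_const[of _ 0]]
  by simp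

text \<open>The Leibniz rule holds because projecting does not change a tangent vector. On the restriction of a
  global field, the chain rule gives the derivative of the lift in the direction of \<open>\<gamma>'\<close>, which
  may be projected to the velocity since lifts are constant on fibres.\<close>

lemma covD_covariant_derivative: "covariant_derivative_along V nabla \<gamma> covD"
proof
  fix X
  assume X: "field_along V \<gamma> X"
  have "smooth_on {0..1} (\<lambda>s. derivative_on_01 X s (\<gamma> s))"
    using smooth_on_01_derivative[OF field_along_smooth[OF X]] smooth_curve
    by (rule smooth_on_blinfun_apply)
  then show "field_along V \<gamma> (covD X)"
    unfolding covD_def by (rule field_along_tvec)
next
  fix X Y s
  assume X: "field_along V \<gamma> X" and eq: "\<And>s. s \<in> {0..1} \<Longrightarrow> X s = Y s" and s: "s \<in> {0..1::real}"
  have "(Y has_vector_derivative derivative_on_01 X s) (at s within {0..1})"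
    by (rule has_vector_derivative_transform[OF s _ field_along_derivative[OF X s]]) (simp add: eq)
  then have "derivative_on_01 Y s = derivative_on_01 X s"
    using s by (rule derivative_on_01_eqI)
  then show "covD X s = covD Y s"
    by (simp add: covD_def eq[OF s])
next
  fix X Y s
  assume X: "field_along V \<gamma> X" and Y: "field_along V \<gamma> Y" and s: "s \<in> {0..1::real}"
  have "derivative_on_01 (\<lambda>s. X s + Y s) s = derivative_on_01 X s + derivative_on_01 Y s"
    by (rule derivative_on_01_eqI[OF has_vector_derivative_add s]; rule field_along_derivative)
      (fact X Y s)+
  then show "covD (\<lambda>s. X s + Y s) s = covD X s + covD Y s"
    by (simp add: covD_def blinfun.add_left tvec_add)
next
  fix X s and f :: "real \<Rightarrow> real"
  assume X: "field_along V \<gamma> X" and f: "smooth_on {0..1} f" and s: "s \<in> {0..1::real}"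
  have "(f has_real_derivative derivative_on_01 f s) (at s within {0..1})"
    using smooth_on_01_has_vector_derivative[OF f s]
    by (simp add: has_real_derivative_iff_has_vector_derivative)
  then have "derivative_on_01 (\<lambda>s. f s *\<^sub>R X s) s
      = f s *\<^sub>R derivative_on_01 X s + derivative_on_01 f s *\<^sub>R X s"
    by (rule derivative_on_01_eqI[OF has_vector_derivative_scaleR[OF _ field_along_derivative[OF X s]] s])
  then show "covD (\<lambda>s. f s *\<^sub>R X s) s = derivative_on_01 f s *\<^sub>R X s + f s *\<^sub>R covD X s"
    by (simp add: covD_def blinfun.add_left blinfun.scaleR_left tvec_add tvec_scaleR
        field_along_eq_tvec[OF X s])
next
  fix Z s
  assume Z: "smooth_field V Z" and s: "s \<in> {0..1::real}"
  note q = nonisotropic_curve[OF s]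
  note d = smooth_on_01_has_vector_derivative[OF smooth_curve s]
  have "((\<lambda>s. Z (line V (\<gamma> s))) has_vector_derivative
      lift_derivative Z (\<gamma> s) (derivative_on_01 \<gamma> s)) (at s within {0..1})"
    using has_derivative_compose[OF d[unfolded has_vector_derivative_def]
        smooth_field_has_derivative[OF Z q]]
    by (simp add: has_vector_derivative_def
        linear_scale[OF has_derivative_linear[OF smooth_field_has_derivative[OF Z q]]])
  then have "derivative_on_01 (\<lambda>s. Z (line V (\<gamma> s))) s
      = lift_derivative Z (\<gamma> s) (derivative_on_01 \<gamma> s)"
    by (rule derivative_on_01_eqI[OF _ s])
  moreover have "\<nabla> (line V (\<gamma> s)) (velocity V \<gamma> s) Z
      = tvec (\<gamma> s) (lift_derivative Z (\<gamma> s) (derivative_on_01 \<gamma> s) (\<gamma> s))"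
    using nabla_eq[OF q tvec_tangent[OF q] Z] q
    by (simp add: velocity_eq_tvec lift_derivative_proj[OF Z q])
  ultimately show "covD (\<lambda>s. Z (line V (\<gamma> s))) s = \<nabla> (line V (\<gamma> s)) (velocity V \<gamma> s) Z"
    by (simp add: covD_def)
qed

text \<open>The value on restrictions of global fields and the Leibniz rule determine a covariant
  derivative on the span of such restrictions.\<close>

lemma covariant_derivative_lincomb:
  assumes D: "covariant_derivative_along V nabla \<gamma> D" and s: "s \<in> {0..1}" and "finite I"
    and f: "\<And>i. i \<in> I \<Longrightarrow> smooth_on {0..1} (f i)"
    and Z: "\<And>i. i \<in> I \<Longrightarrow> smooth_field V (Z i)"
    and fZ: "\<And>i. i \<in> I \<Longrightarrow> field_along V \<gamma> (\<lambda>s. Z i (line V (\<gamma> s)))"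
  shows "field_along V \<gamma> (\<lambda>s. \<Sum>i\<in>I. f i s *\<^sub>R Z i (line V (\<gamma> s)))
    \<and> D (\<lambda>s. \<Sum>i\<in>I. f i s *\<^sub>R Z i (line V (\<gamma> s))) s
      = (\<Sum>i\<in>I. derivative_on_01 (f i) s *\<^sub>R Z i (line V (\<gamma> s))
          + f i s *\<^sub>R \<nabla> (line V (\<gamma> s)) (velocity V \<gamma> s) (Z i))"
  using assms(3-)
proof (induction I rule: finite_induct)
  case empty
  have "D (\<lambda>s. 0 *\<^sub>R 0) s = derivative_on_01 (\<lambda>s. 0::real) s *\<^sub>R 0 + 0 *\<^sub>R D (\<lambda>s. 0) s"
    by (rule covariant_derivative_along.leibniz[OF D field_along_zero smooth_on_const s])
  then show ?case using field_along_zero by simp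
next
  case (insert i I)
  have i: "field_along V \<gamma> (\<lambda>s. f i s *\<^sub>R Z i (line V (\<gamma> s)))"
    using insert.prems by (intro field_along_scaleR) auto
  have IH: "field_along V \<gamma> (\<lambda>s. \<Sum>i\<in>I. f i s *\<^sub>R Z i (line V (\<gamma> s)))"
    "D (\<lambda>s. \<Sum>i\<in>I. f i s *\<^sub>R Z i (line V (\<gamma> s))) s
      = (\<Sum>i\<in>I. derivative_on_01 (f i) s *\<^sub>R Z i (line V (\<gamma> s))
          + f i s *\<^sub>R \<nabla> (line V (\<gamma> s)) (velocity V \<gamma> s) (Z i))"
    using insert.IH insert.prems by auto
  have "D (\<lambda>s. f i s *\<^sub>R Z i (line V (\<gamma> s))) s
      = derivative_on_01 (f i) s *\<^sub>R Z i (line V (\<gamma> s))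
        + f i s *\<^sub>R \<nabla> (line V (\<gamma> s)) (velocity V \<gamma> s) (Z i)"
    using covariant_derivative_along.leibniz[OF D _ _ s] covariant_derivative_along.induced[OF D _ s]
      insert.prems by simp
  then show ?case
    using insert.hyps covariant_derivative_along.add[OF D i IH(1) s] IH(2)
      field_along_add[OF i IH(1)] by simp
qed

text \<open>Expanding both \<open>X(\<gamma>)\<close> and \<open>\<gamma>\<close> in a real basis writes \<open>X\<close> as a combination, with smooth
  coefficients, of fields spread from the constant rank-one maps \<open>v \<mapsto> b \<cdot> \<langle>c, v\<rangle>\<close>.\<close>

lemma field_along_expansion:
  assumes X: "field_along V \<gamma> X" and s: "s \<in> {0..1}"
  shows "X s = (\<Sum>(b, c)\<in>Basis \<times> Basis.
    ((X s (\<gamma> s) \<bullet> b) * (\<gamma> s \<bullet> c) * inverse (qf (\<gamma> s))) *\<^sub>R spread_field (rank1 b c) (line V (\<gamma> s)))"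
proof -
  note q = nonisotropic_curve[OF s]
  define w where "w = X s (\<gamma> s)"
  have "w \<cdot> \<langle>\<gamma> s, \<gamma> s\<rangle> = (\<Sum>b\<in>Basis. (w \<bullet> b) *\<^sub>R b) \<cdot> \<langle>\<Sum>c\<in>Basis. (\<gamma> s \<bullet> c) *\<^sub>R c, \<gamma> s\<rangle>"
    by (simp only: euclidean_representation)
  also have "\<dots> = (\<Sum>b\<in>Basis. \<Sum>c\<in>Basis. ((w \<bullet> b) * (\<gamma> s \<bullet> c)) *\<^sub>R (b \<cdot> \<langle>c, \<gamma> s\<rangle>))"
    by (simp add: bounded_bilinear.sum_left[OF bounded_bilinear_smul]
        bounded_bilinear.sum_right[OF bounded_bilinear_smul]
        bounded_bilinear.sum_left[OF bounded_bilinear_herm]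
        smul_scaleR_left smul_scaleR_right herm_scaleR_left scaleR_sum_right mult.commute)
      (rule sum.swap)
  finally have "qf (\<gamma> s) *\<^sub>R w
      = (\<Sum>(b, c)\<in>Basis \<times> Basis. ((w \<bullet> b) * (\<gamma> s \<bullet> c)) *\<^sub>R (b \<cdot> \<langle>c, \<gamma> s\<rangle>))"
    by (simp add: herm_self smul_of_real sum.cartesian_product)
  then have "inverse (qf (\<gamma> s)) *\<^sub>R (qf (\<gamma> s) *\<^sub>R w)
      = (\<Sum>(b, c)\<in>Basis \<times> Basis. ((w \<bullet> b) * (\<gamma> s \<bullet> c) * inverse (qf (\<gamma> s))) *\<^sub>R (b \<cdot> \<langle>c, \<gamma> s\<rangle>))"
    by (simp add: scaleR_sum_right case_prod_beta mult.commute)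
  then have "tvec (\<gamma> s) w = tvec (\<gamma> s)
      (\<Sum>(b, c)\<in>Basis \<times> Basis. ((w \<bullet> b) * (\<gamma> s \<bullet> c) * inverse (qf (\<gamma> s))) *\<^sub>R (b \<cdot> \<langle>c, \<gamma> s\<rangle>))"
    using q by simp
  then show ?thesis
    using field_along_eq_tvec[OF X s]
    by (simp add: w_def tvec_sum tvec_scaleR case_prod_beta spread_field_line[OF klinear_rank1 q])
qed

lemma covariant_derivative_unique:
  assumes D: "covariant_derivative_along V nabla \<gamma> D" and X: "field_along V \<gamma> X"
    and s: "s \<in> {0..1}"
  shows "D X s = covD X s"
proof -
  define f where "f i s = (X s (\<gamma> s) \<bullet> fst i) * (\<gamma> s \<bullet> snd i) * inverse (qf (\<gamma> s))"
    for i :: "'v \<times> 'v" and s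
  define Z where "Z i = spread_field (rank1 (fst i) (snd i))" for i :: "'v \<times> 'v"
  let ?I = "Basis \<times> Basis :: ('v \<times> 'v) set"
  let ?S = "\<lambda>s. \<Sum>i\<in>?I. f i s *\<^sub>R Z i (line V (\<gamma> s))"
  have f: "smooth_on {0..1} (f i)" for i
    unfolding f_def using nonisotropic_curve
    by (intro smooth_on_mult smooth_on_inner smooth_on_blinfun_apply field_along_smooth[OF X]
        smooth_curve smooth_on_const smooth_on_inverse smooth_on_qf)
  have Z: "smooth_field V (Z i)" for i
    unfolding Z_def by (rule smooth_field_spread_field[OF klinear_rank1])
  have fZ: "field_along V \<gamma> (\<lambda>s. Z i (line V (\<gamma> s)))" for i
  proof (rule field_along_cong[OF field_along_tvec])
    show "smooth_on {0..1} (\<lambda>s. rank1 (fst i) (snd i) (\<gamma> s))"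
      by (intro smooth_on_blinfun_apply smooth_on_const smooth_curve)
  qed (use nonisotropic_curve in \<open>simp add: Z_def spread_field_line[OF klinear_rank1]\<close>)
  have fin: "finite ?I" by simp
  have XS: "X s = ?S s" if "s \<in> {0..1}" for s
    using field_along_expansion[OF X that] by (simp add: f_def Z_def case_prod_beta)
  have "E X s = (\<Sum>i\<in>?I. derivative_on_01 (f i) s *\<^sub>R Z i (line V (\<gamma> s))
          + f i s *\<^sub>R \<nabla> (line V (\<gamma> s)) (velocity V \<gamma> s) (Z i))"
    if E: "covariant_derivative_along V nabla \<gamma> E" for E
    using covariant_derivative_lincomb[OF E s fin f Z fZ]
      covariant_derivative_along.cong[OF E X _ XS s] by simp
  from this[OF D] this[OF covD_covariant_derivative] show ?thesis by simp
qed

lemma parallel_along_iff: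
  "parallel_along V nabla \<gamma> X \<longleftrightarrow> field_along V \<gamma> X \<and> (\<forall>s\<in>{0..1}. covD X s = 0)"
  unfolding parallel_along_def
  using covD_covariant_derivative covariant_derivative_unique by metis

text \<open>For a parallel field, the value \<open>X(\<gamma>)\<close> solves a homogeneous linear differential equation:
  parallelism gives the component of its derivative orthogonal to \<open>\<gamma>\<close>, and the orthogonality of
  \<open>X(\<gamma>)\<close> to \<open>\<gamma>\<close> gives the other one.\<close>

lemma parallel_value_derivative:
  assumes X: "field_along V \<gamma> X" and s: "s \<in> {0..1}" and par: "covD X s = 0"
  shows "((\<lambda>s. X s (\<gamma> s)) has_vector_derivative
    (1 / qf (\<gamma> s)) *\<^sub>R (X s (\<gamma> s) \<cdot> \<langle>\<gamma> s, derivative_on_01 \<gamma> s\<rangle>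
      - \<gamma> s \<cdot> \<langle>derivative_on_01 \<gamma> s, X s (\<gamma> s)\<rangle>)) (at s within {0..1})"
proof -
  define x y w u where "x = \<gamma> s" and "y = derivative_on_01 \<gamma> s" and "w = X s (\<gamma> s)"
    and "u = X s y + derivative_on_01 X s x"
  note q = nonisotropic_curve[OF s, folded x_def]
  note t = field_along_tangent[OF X s, folded x_def]
  note dg = smooth_on_01_has_vector_derivative[OF smooth_curve s, folded y_def]
  have du: "((\<lambda>s. X s (\<gamma> s)) has_vector_derivative u) (at s within {0..1})"
    unfolding u_def x_def
    by (rule bounded_bilinear.has_vector_derivative[OF bounded_bilinear_blinfun_apply
          field_along_derivative[OF X s] dg])
  have "((\<lambda>s. \<langle>\<gamma> s, X s (\<gamma> s)\<rangle>) has_vector_derivative \<langle>x, u\<rangle> + \<langle>y, w\<rangle>) (at s within {0..1})"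
    unfolding x_def w_def
    by (rule bounded_bilinear.has_vector_derivative[OF bounded_bilinear_herm dg du])
  then have "((\<lambda>s. 0) has_vector_derivative \<langle>x, u\<rangle> + \<langle>y, w\<rangle>) (at s within {0..1})"
    by (rule has_vector_derivative_transform[OF s, rotated])
      (use tangent_herm[OF field_along_tangent[OF X]] in simp)
  from derivative_on_01_eqI[OF this s]
    derivative_on_01_eqI[OF has_vector_derivative_const[of "0::'k"] s]
  have xu: "\<langle>x, u\<rangle> = - \<langle>y, w\<rangle>"
    by (simp add: eq_neg_iff_add_eq_0)
  have "proj V x (derivative_on_01 X s x) = covD X s x"
    using q by (simp add: covD_def x_def)
  then have "proj V x u = proj V x (X s y)"
    using par by (simp add: u_def proj_add)
  also have "\<dots> = (1 / qf x) *\<^sub>R (w \<cdot> \<langle>x, y\<rangle>)"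
    using tangent_eq_tvec[OF t q] tangent_herm[OF t] tvec_apply[of x w y]
    by (simp add: w_def x_def proj_scaleR proj_smul)
  finally have "u = (1 / qf x) *\<^sub>R (w \<cdot> \<langle>x, y\<rangle> - x \<cdot> \<langle>y, w\<rangle>)"
    by (simp add: proj_eq xu smul_minus_right algebra_simps)
  with du show ?thesis by (simp add: x_def y_def w_def)
qed

lemma parallel_along_zero:
  assumes par: "parallel_along V nabla \<gamma> X" and "X 0 = 0"
  shows "X 1 = 0"
proof -
  have X: "field_along V \<gamma> X" and p: "\<And>s. s \<in> {0..1} \<Longrightarrow> covD X s = 0"
    using par by (auto simp: parallel_along_iff)
  let ?y = "derivative_on_01 \<gamma>"
  define w where "w s = X s (\<gamma> s)" for s
  define A where "A s u = (1 / qf (\<gamma> s)) *\<^sub>R (u \<cdot> \<langle>\<gamma> s, ?y s\<rangle> - \<gamma> s \<cdot> \<langle>?y s, u\<rangle>)" for s u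
  obtain K where K: "K > 0" "\<And>v k. norm (v \<cdot> k) \<le> norm v * norm k * K"
    using bounded_bilinear.pos_bounded[OF bounded_bilinear_smul] by blast
  obtain H where H: "H > 0" "\<And>v u. norm \<langle>v, u\<rangle> \<le> norm v * norm u * H"
    using bounded_bilinear.pos_bounded[OF bounded_bilinear_herm] by blast
  define M where "M s = \<bar>inverse (qf (\<gamma> s))\<bar> * (2 * (norm (\<gamma> s) * norm (?y s)) * (H * K))" for s
  have "continuous_on {0..1} M"
    unfolding M_def using nonisotropic_curve
    by (intro continuous_intros smooth_on_imp_continuous_on smooth_on_qf smooth_on_01_derivative
        smooth_curve) auto
  then have "bounded (M ` {0..1})"
    by (intro compact_imp_bounded compact_continuous_image) auto
  then obtain C where C: "\<And>s. s \<in> {0..1} \<Longrightarrow> M s \<le> C"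
    unfolding bounded_iff by (force simp: abs_le_iff)
  have "norm (A s u) \<le> C * norm u" if s: "s \<in> {0..1}" for s u
  proof -
    have "norm (u \<cdot> \<langle>\<gamma> s, ?y s\<rangle> - \<gamma> s \<cdot> \<langle>?y s, u\<rangle>)
        \<le> norm u * norm \<langle>\<gamma> s, ?y s\<rangle> * K + norm (\<gamma> s) * norm \<langle>?y s, u\<rangle> * K"
      by (intro order_trans[OF norm_triangle_ineq4] add_mono K)
    also have "\<dots> \<le> norm u * (norm (\<gamma> s) * norm (?y s) * H) * K
        + norm (\<gamma> s) * (norm (?y s) * norm u * H) * K"
      using K(1) by (intro add_mono mult_right_mono mult_left_mono H) auto
    also have "\<dots> = 2 * (norm (\<gamma> s) * norm (?y s)) * (H * K) * norm u"
      by (simp add: algebra_simps)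
    finally have "norm (A s u) \<le> M s * norm u"
      by (simp add: A_def M_def divide_inverse mult.assoc mult_left_mono)
    also have "\<dots> \<le> C * norm u"
      using C[OF s] by (rule mult_right_mono) simp
    finally show ?thesis .
  qed
  then have "w 1 = 0"
    using parallel_value_derivative[OF X _ p] assms(2)
    by (intro linear_growth_zero[of w "\<lambda>s. A s (w s)" C]) (auto simp: w_def[abs_def] A_def)
  then show ?thesis
    using field_along_eq_tvec[OF X, of 1] by (simp add: w_def tvec_eq_0 proj_eq)
qed

lemma parallel_along_unique:
  assumes X: "parallel_along V nabla \<gamma> X" and Y: "parallel_along V nabla \<gamma> Y" and eq: "X 0 = Y 0"
  shows "X 1 = Y 1"
proof -
  have fX: "field_along V \<gamma> X" and fY: "field_along V \<gamma> Y"
    using X Y by (auto simp: parallel_along_iff)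
  have "covD (\<lambda>s. X s - Y s) s = covD X s - covD Y s" if s: "s \<in> {0..1}" for s
    using covariant_derivative_along.add[OF covD_covariant_derivative field_along_diff[OF fX fY] fY s]
    by simp
  then have "parallel_along V nabla \<gamma> (\<lambda>s. X s - Y s)"
    using X Y field_along_diff[OF fX fY] by (simp add: parallel_along_iff)
  from parallel_along_zero[OF this] show ?thesis using eq by simp
qed

lemma parallel_transport_eq:
  assumes "parallel_along V nabla \<gamma> X"
  shows "parallel_transport V nabla \<gamma> (X 0) = X 1"
  unfolding parallel_transport_def
  using assms parallel_along_unique by (intro the_equality) blast+

end


section \<open>Segments of geodesics\<close>

text \<open>Leaving the interval would force the path, by the intermediate value theorem, to take the value of
  one of its end points a second time.\<close>

lemma injective_path_in_unit_interval:
  fixes \<tau> :: "real \<Rightarrow> real"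
  assumes "continuous_on {0..1} \<tau>" "inj_on \<tau> {0..1}" "\<tau> 0 = 0" "\<tau> 1 = 1" "s \<in> {0..1}"
  shows "\<tau> s \<in> {0..1}"
proof (rule ccontr)
  assume "\<tau> s \<notin> {0..1}"
  then consider "\<tau> s < 0" | "\<tau> s > 1" by force
  then show False
  proof cases
    case 1
    have "continuous_on {s..1} \<tau>"
      using assms(1,5) by (auto intro: continuous_on_subset)
    then obtain r where "s \<le> r" "r \<le> 1" "\<tau> r = 0"
      using IVT'[of \<tau> s 0 1] 1 assms(4,5) by auto
    then have "r = 0" "s = 0"
      using inj_onD[OF assms(2), of r 0] assms(3,5) by auto
    then show False using 1 assms(3) by simp
  next
    case 2
    have "continuous_on {0..s} \<tau>"
      using assms(1,5) by (auto intro: continuous_on_subset)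
    then obtain r where "0 \<le> r" "r \<le> s" "\<tau> r = 1"
      using IVT'[of \<tau> 0 1 s] 2 assms(3,5) by auto
    then have "r = 1" "s = 1"
      using inj_onD[OF assms(2), of r 1] assms(4,5) by auto
    then show False using 2 assms(4) by simp
  qed
qed

context hermitian_space
begin

text \<open>In the real plane \<open>W\<close>, the vectors having a given product with \<open>x\<close> form an affine line.\<close>

lemma geodesic_subspace_affine:
  assumes W: "geodesic_subspace V W" and x: "x \<in> W" "qf x \<noteq> 0" and e: "e \<in> W" "e \<noteq> 0" "\<langle>x, e\<rangle> = 0"
    and y: "y \<in> W" "\<langle>x, y\<rangle> = \<langle>x, x\<rangle>"
  obtains b where "y = x + b *\<^sub>R e"
proof -
  have "x \<notin> span {e}"
  proof
    assume "x \<in> span {e}"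
    then obtain c where "x = c *\<^sub>R e" by (auto simp: span_singleton)
    then have "\<langle>x, x\<rangle> = c *\<^sub>R \<langle>x, e\<rangle>" by (metis herm_scaleR_right)
    then show False using x(2) e(3) by (simp add: herm_self)
  qed
  moreover have "x \<noteq> e" using x(2) e(3) by (auto simp: herm_self)
  ultimately have "independent {x, e}" "card {x, e} = 2"
    using e(2) by (simp_all add: independent_insert)
  then have "W \<subseteq> span {x, e}"
    using W x(1) e(1) by (intro card_ge_dim_independent) (auto simp: geodesic_subspace_def)
  then obtain a where "y - a *\<^sub>R x \<in> span {e}"
    using y(1) unfolding span_insert by blast
  then obtain b where "y - a *\<^sub>R x = b *\<^sub>R e"
    by (auto simp: span_singleton)
  then have "y = a *\<^sub>R x + b *\<^sub>R e"
    by (simp add: algebra_simps)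
  moreover from this have "a *\<^sub>R \<langle>x, x\<rangle> = 1 *\<^sub>R \<langle>x, x\<rangle>"
    using y(2) e(3) by (simp add: herm_add_right herm_scaleR_right)
  then have "a = 1"
    using x(2) by (simp only: scaleR_cancel_right) (simp add: herm_self)
  ultimately show ?thesis
    using that[of b] by simp
qed

lemma smooth_on_conj: "smooth_on S f \<Longrightarrow> smooth_on S (\<lambda>x. conj (f x :: 'k))"
  by (rule smooth_on_linear[OF linear_conj[unfolded linear_conv_bounded_linear]])

text \<open>The lift of a curve normalized by \<open>\<langle>p, x\<rangle> = \<langle>p, p\<rangle>\<close>. This normalization removes the
  scalar ambiguity of the lift, so that the lift of a geodesic runs in an affine real line.\<close>

definition normalized :: "'v \<Rightarrow> 'v \<Rightarrow> 'v" where
  "normalized p x = (qf p * inverse (\<langle>p, x\<rangle> \<bullet> \<langle>p, x\<rangle>)) *\<^sub>R (x \<cdot> conj \<langle>p, x\<rangle>)"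

lemma herm_normalized: "\<langle>p, x\<rangle> \<noteq> 0 \<Longrightarrow> \<langle>p, normalized p x\<rangle> = \<langle>p, p\<rangle>"
  by (simp add: normalized_def herm_scaleR_right herm_smul_right times_conj_self herm_self
      power2_norm_eq_inner of_real_def)

lemma normalized_eq_smul:
  assumes "\<langle>p, x\<rangle> \<noteq> 0" "qf p \<noteq> 0"
  obtains c where "c \<noteq> 0" "normalized p x = x \<cdot> c"
proof
  let ?c = "(qf p * inverse (\<langle>p, x\<rangle> \<bullet> \<langle>p, x\<rangle>)) *\<^sub>R conj \<langle>p, x\<rangle>"
  show "normalized p x = x \<cdot> ?c"
    by (simp add: normalized_def smul_scaleR_right)
  have "conj \<langle>p, x\<rangle> \<noteq> 0"
    using assms(1) by (metis norm_conj norm_eq_zero)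
  then show "?c \<noteq> 0" using assms by simp
qed

lemma normalized_smul_self: "k \<noteq> 0 \<Longrightarrow> qf p \<noteq> 0 \<Longrightarrow> normalized p (p \<cdot> k) = p"
proof -
  assume k: "k \<noteq> 0" and p: "qf p \<noteq> 0"
  have "\<langle>p, p \<cdot> k\<rangle> = qf p *\<^sub>R k"
    by (simp add: herm_smul_right herm_self of_real_def)
  then show ?thesis
    using k p by (simp add: normalized_def conj_scaleR smul_scaleR_right smul_smul[symmetric]
        times_conj_self power2_norm_eq_inner) (simp add: field_simps)
qed

lemma smooth_on_normalized:
  assumes "smooth_on S f" "\<And>s. s \<in> S \<Longrightarrow> \<langle>p, f s\<rangle> \<noteq> 0"
  shows "smooth_on S (\<lambda>s. normalized p (f s))"
  unfolding normalized_def
  by (intro smooth_on_scaleR smooth_on_mult smooth_on_const smooth_on_inverse smooth_on_inner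
      smooth_on_smul smooth_on_conj smooth_on_herm assms) (simp add: assms)

text \<open>The form is real on \<open>W\<close>, so the normalization relative to \<open>p = x \<cdot> m\<close> turns the multiples of \<open>y\<close>
  into a real multiple of \<open>y \<cdot> m\<close>: the same scalar \<open>m\<close> serves for the whole geodesic.\<close>

lemma normalized_in_geodesic:
  assumes W: "geodesic_subspace V W" and x: "x \<in> W" and y: "y \<in> W" and p: "p = x \<cdot> m"
  obtains y' where "y' \<in> W" "normalized p (y \<cdot> c) = y' \<cdot> m"
proof -
  have sub: "subspace W" and "\<langle>x, y\<rangle> \<in> \<real>"
    using W x y by (auto simp: geodesic_subspace_def)
  then obtain r where r: "\<langle>x, y\<rangle> = of_real r" by (auto elim: Reals_cases)
  have "\<langle>p, y \<cdot> c\<rangle> = r *\<^sub>R (conj m * c)"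
    by (simp add: p herm_smul_left herm_smul_right r of_real_def)
  then have "(y \<cdot> c) \<cdot> conj \<langle>p, y \<cdot> c\<rangle> = r *\<^sub>R ((y \<cdot> (c * conj c)) \<cdot> m)"
    by (simp add: conj_scaleR conj_mult conj_conj smul_scaleR_right smul_smul)
  also have "\<dots> = (r * (norm c)\<^sup>2) *\<^sub>R (y \<cdot> m)"
    by (simp add: times_conj_self smul_scaleR_right smul_scaleR_left)
  finally have "normalized p (y \<cdot> c) = ((qf p * inverse (\<langle>p, y \<cdot> c\<rangle> \<bullet> \<langle>p, y \<cdot> c\<rangle>) * (r * (norm c)\<^sup>2)) *\<^sub>R y) \<cdot> m"
    by (simp add: normalized_def smul_scaleR_left)
  then show ?thesis
    using that subspace_scale[OF sub y] by blast
qed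

lemma qf_add_orthogonal: "\<langle>p, e\<rangle> = 0 \<Longrightarrow> qf (p + r *\<^sub>R e) = qf p + r\<^sup>2 * qf e"
  using herm_eq_0_commute[of p e]
  by (simp add: qf_def herm_add_left herm_add_right herm_scaleR_left herm_scaleR_right re_add
      re_scaleR power2_eq_square)

text \<open>A lift of the segment in the affine line \<open>p + \<real> e\<close>. Its parameter stays between the values
  at the end points because the segment is a simple arc. Where the form is indefinite on the
  geodesic, this keeps the segment away from the isotropic points.\<close>

lemma segment_lift:
  assumes seg: "parametrizes_segment V p q \<gamma>" and p: "qf p \<noteq> 0" and q: "qf q \<noteq> 0"
    and sign: "sgn (qf p) = sgn (qf q)" and ne: "line V p \<noteq> line V q"
  obtains e \<tau> c where "\<langle>p, e\<rangle> = 0" "c \<noteq> 0" "p + e = q \<cdot> c"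
    "smooth_on {0..1} \<tau>" "\<tau> 0 = 0" "\<tau> 1 = 1"
    "\<And>s. s \<in> {0..1} \<Longrightarrow> line V (p + \<tau> s *\<^sub>R e) = line V (\<gamma> s)"
    "\<And>s. s \<in> {0..1} \<Longrightarrow> 1 + qf e / qf p * (\<tau> s)\<^sup>2 > 0"
proof -
  have \<gamma>: "smooth_on {0..1} \<gamma>" and inj: "inj_on (\<lambda>s. line V (\<gamma> s)) {0..1}"
    and nz: "\<And>s. s \<in> {0..1} \<Longrightarrow> \<gamma> s \<noteq> 0"
    and ends: "line V (\<gamma> 0) = line V p" "line V (\<gamma> 1) = line V q"
    and no: "\<And>s. s \<in> {0..1} \<Longrightarrow> \<langle>p, \<gamma> s\<rangle> \<noteq> 0"
    using seg by (auto simp: parametrizes_segment_def)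
  obtain W where W: "geodesic_subspace V W"
    and onW: "\<And>s. s \<in> {0..1} \<Longrightarrow> line V (\<gamma> s) \<in> line V ` (W - {0})"
    using seg by (auto simp: parametrizes_segment_def)
  have sub: "subspace W" using W by (simp add: geodesic_subspace_def)
  define g where "g s = normalized p (\<gamma> s)" for s
  define e where "e = g 1 - p"
  define \<tau> where "\<tau> s = ((g s - p) \<bullet> e) * inverse (e \<bullet> e)" for s
  have g: "smooth_on {0..1} g"
    unfolding g_def[abs_def] by (rule smooth_on_normalized[OF \<gamma> no])
  have gline: "line V (g s) = line V (\<gamma> s)" if s: "s \<in> {0..1}" for s
    using normalized_eq_smul[OF no[OF s] p] line_smul unfolding g_def by metis
  have pg: "\<langle>p, g s\<rangle> = \<langle>p, p\<rangle>" if "s \<in> {0..1}" for s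
    unfolding g_def by (rule herm_normalized[OF no[OF that]])
  obtain k where "k \<noteq> 0" "\<gamma> 0 = p \<cdot> k"
    using line_eqE[OF ends(1)[symmetric] nz[of 0]] by auto
  then have g0: "g 0 = p"
    using p by (simp add: g_def normalized_smul_self)
  have "g 1 \<noteq> 0"
    using pg[of 1] p by (auto simp: herm_self)
  then obtain c where c: "c \<noteq> 0" "g 1 = q \<cdot> c"
    using line_eqE[of q "g 1"] gline[of 1] ends(2) by auto
  have "e \<noteq> 0"
    using gline[of 1] ends(2) ne by (auto simp: e_def)
  have pe: "\<langle>p, e\<rangle> = 0"
    using pg[of 1] by (simp add: e_def herm_diff_right)

  have "line V p \<in> line V ` (W - {0})"
    using onW[of 0] ends(1) by simp
  then obtain x where x: "x \<in> W" "line V x = line V p" by force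
  then obtain m where m: "m \<noteq> 0" "p = x \<cdot> m"
    using line_eqE[OF x(2) qf_nonzero_imp[OF p]] by blast
  have qx: "qf x \<noteq> 0" using p m by (auto simp: qf_smul)
  have gW: "\<exists>y\<in>W. g s = y \<cdot> m" if s: "s \<in> {0..1}" for s
  proof -
    obtain y where y: "y \<in> W" "line V y = line V (\<gamma> s)" using onW[OF s] by force
    then obtain d where "\<gamma> s = y \<cdot> d"
      using line_eqE[OF y(2) nz[OF s]] by blast
    then show ?thesis
      using normalized_in_geodesic[OF W x(1) y(1) m(2)] unfolding g_def by metis
  qed
  obtain y1 where y1: "y1 \<in> W" "g 1 = y1 \<cdot> m" using gW[of 1] by auto
  have em: "e = (y1 - x) \<cdot> m" by (simp add: e_def y1 m smul_diff_left)
  have cancel: "\<langle>x, y\<rangle> = \<langle>x, z\<rangle>" if "\<langle>p, y \<cdot> m\<rangle> = \<langle>p, z \<cdot> m\<rangle>" for y z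
  proof -
    have "conj m \<noteq> 0" using m(1) by (metis norm_conj norm_eq_zero)
    then show ?thesis using that m(1) by (simp add: m(2) herm_smul_left herm_smul_right)
  qed
  have affine: "g s = p + \<tau> s *\<^sub>R e" if s: "s \<in> {0..1}" for s
  proof -
    obtain y where y: "y \<in> W" "g s = y \<cdot> m" using gW[OF s] by auto
    have "\<langle>x, y\<rangle> = \<langle>x, x\<rangle>"
      using cancel[of y x] pg[OF s] y(2) m(2) by simp
    moreover have "\<langle>x, y1 - x\<rangle> = 0"
      using cancel[of "y1 - x" 0] pe em by simp
    moreover have "y1 - x \<noteq> 0" using \<open>e \<noteq> 0\<close> em by auto
    ultimately obtain b where "y = x + b *\<^sub>R (y1 - x)"
      using geodesic_subspace_affine[OF W x(1) qx subspace_diff[OF sub y1(1) x(1)] _ _ y(1)] by blast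
    then have "g s = p + b *\<^sub>R e"
      by (simp add: y(2) m(2) em smul_add_left smul_scaleR_left)
    moreover from this have "\<tau> s = b"
      using \<open>e \<noteq> 0\<close> by (simp add: \<tau>_def)
    ultimately show ?thesis by simp
  qed
  have \<tau>: "smooth_on {0..1} \<tau>"
    unfolding \<tau>_def[abs_def]
    by (intro smooth_on_mult smooth_on_inner smooth_on_diff g smooth_on_const)
  have \<tau>0: "\<tau> 0 = 0" and \<tau>1: "\<tau> 1 = 1"
    using \<open>e \<noteq> 0\<close> by (simp_all add: \<tau>_def g0 e_def[symmetric])
  have "inj_on \<tau> {0..1}"
    using inj affine gline unfolding inj_on_def by metis
  then have range: "\<tau> s \<in> {0..1}" if "s \<in> {0..1}" for s
    using injective_path_in_unit_interval[OF smooth_on_imp_continuous_on[OF \<tau>] _ \<tau>0 \<tau>1 that] by blast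
  have "qf p + qf e = (norm c)\<^sup>2 * qf q"
    using qf_add_orthogonal[OF pe, of 1] c(2) by (simp add: e_def qf_smul[symmetric])
  then have "1 + qf e / qf p = (norm c)\<^sup>2 * (qf q / qf p)"
    using p by (simp add: field_simps)
  moreover have "qf q / qf p > 0"
    using sign p q by (auto simp: sgn_if zero_less_divide_iff split: if_splits)
  ultimately have end_pos: "1 + qf e / qf p > 0"
    using c(1) by (metis mult_pos_pos zero_less_norm_iff zero_less_power)
  have "1 + qf e / qf p * (\<tau> s)\<^sup>2 > 0" if s: "s \<in> {0..1}" for s
  proof (cases "qf e / qf p \<ge> 0")
    case True
    then show ?thesis by (intro add_pos_nonneg mult_nonneg_nonneg) auto
  next
    case False
    have "(\<tau> s)\<^sup>2 \<le> 1" using range[OF s] by (auto intro: power_le_one)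
    then have "qf e / qf p * 1 \<le> qf e / qf p * (\<tau> s)\<^sup>2"
      using False by (intro mult_left_mono_neg) auto
    then show ?thesis using end_pos by linarith
  qed
  then show ?thesis
  proof (intro that[of e c \<tau>] pe c(1) \<tau> \<tau>0 \<tau>1)
    show "p + e = q \<cdot> c" using c(2) by (simp add: e_def)
    show "line V (p + \<tau> s *\<^sub>R e) = line V (\<gamma> s)" if "s \<in> {0..1}" for s
      using affine[OF that] gline[OF that] by simp
  qed
qed


section \<open>Parallel transport along the segment\<close>

lemma ta_eq: "ta V p x = (norm \<langle>p, x\<rangle>)\<^sup>2 / (qf p * qf x)"
proof -
  have "\<langle>p, x\<rangle> * \<langle>x, p\<rangle> = of_real ((norm \<langle>p, x\<rangle>)\<^sup>2)"
    using times_conj_self[of "\<langle>p, x\<rangle>"] herm_conj[of x p] by (simp add: of_real_def)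
  moreover have "\<langle>p, p\<rangle> * \<langle>x, x\<rangle> = of_real (qf p * qf x)"
    by (simp add: herm_self)
  ultimately show ?thesis
    by (simp only: ta_def flip: of_real_divide) (simp only: re_of_real)
qed

lemma ta_smul: "k \<noteq> 0 \<Longrightarrow> ta V p (x \<cdot> k) = ta V p x"
  by (simp add: ta_eq herm_smul_right norm_mult power_mult_distrib qf_smul)

lemma spread_smul: "klinear V t \<Longrightarrow> k \<noteq> 0 \<Longrightarrow> spread V t (x \<cdot> k) = spread V t x"
  by (simp add: spread_eq_tvec tvec_smul klinear_def)

lemma span2_smul: "y \<in> span2 V p q \<Longrightarrow> y \<cdot> k \<in> span2 V p q"
  unfolding span2_def by (force simp: smul_add_left smul_smul[symmetric])

text \<open>The value of \<open>h\<close> lies in the plane spanned by \<open>p\<close> and \<open>e\<close>, and it is orthogonal to \<open>p\<close>.\<close>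

lemma horizontal_value:
  assumes h: "h \<in> tangent_to_line V (span2 V p q) (line V p)"
    and p: "qf p \<noteq> 0" and pe: "\<langle>p, e\<rangle> = 0" and c: "c \<noteq> 0" "p + e = q \<cdot> c"
  obtains k where "h p = e \<cdot> k"
proof -
  have t: "h \<in> tangent_space V (line V p)" and "h p \<in> span2 V p q"
    using h line_self by (auto simp: tangent_to_line_def)
  then obtain a b where ab: "h p = p \<cdot> a + q \<cdot> b" by (auto simp: span2_def)
  have "q = (p + e) \<cdot> inverse c"
    unfolding c(2) using c(1) by (simp add: smul_inverse_cancel)
  then have hp: "h p = p \<cdot> (a + inverse c * b) + e \<cdot> (inverse c * b)"
    by (simp add: ab smul_add_left smul_add_right smul_smul)
  then have "of_real (qf p) * (a + inverse c * b) = 0"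
    using tangent_herm[OF t] pe by (simp add: herm_add_right herm_smul_right herm_self)
  then show ?thesis
    using hp p that by simp
qed

text \<open>Orthogonality to the tangent vector \<open>p \<mapsto> e \<cdot> k\<close> makes a real part vanish; letting \<open>k\<close> run
  through all scalars gives hermitian orthogonality.\<close>

lemma vertical_value:
  assumes v: "v \<in> normal_to_line V \<sigma> (span2 V p q) (line V p)" and "\<sigma> \<noteq> 0"
    and p: "qf p \<noteq> 0" and pe: "\<langle>p, e\<rangle> = 0" and e: "p + e = q \<cdot> c"
  shows "\<langle>e, v p\<rangle> = 0"
proof (rule re_mult_eq_0_imp)
  fix k :: 'k
  have t: "v \<in> tangent_space V (line V p)"
    using v by (simp add: normal_to_line_def)
  let ?k = "conj k"
  have "e = p \<cdot> (- 1) + q \<cdot> c"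
    by (simp add: e[symmetric] smul_minus_right)
  then have "e \<in> span2 V p q"
    unfolding span2_def by blast
  then have L: "(e \<cdot> ?k) \<cdot> l \<in> span2 V p q" for l
    by (intro span2_smul)
  have pek: "\<langle>p, e \<cdot> ?k\<rangle> = 0"
    by (simp add: herm_smul_right pe)
  have "tvec p (e \<cdot> ?k) (p \<cdot> l) = (e \<cdot> ?k) \<cdot> l" for l
    using tangent_klinear[OF tvec_tangent[OF p]] p pek by simp
  then have "tvec p (e \<cdot> ?k) \<in> tangent_to_line V (span2 V p q) (line V p)"
    using tvec_tangent[OF p] L by (auto simp: tangent_to_line_def line_def)
  then have "metric V \<sigma> (tvec p (e \<cdot> ?k)) v = 0"
    using v by (simp add: normal_to_line_def)
  then have "re \<langle>e \<cdot> ?k, v p\<rangle> = 0"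
    using metric_eq[OF tvec_tangent[OF p] t p] assms(2) p pek by simp
  then have "re (k * \<langle>e, v p\<rangle>) = 0"
    by (simp add: herm_smul_left conj_conj)
  then show "re (\<langle>e, v p\<rangle> * k) = 0"
    by (simp only: re_mult_commute)
qed

end

context nonisotropic_curve
begin

lemma derivative_klinear:
  assumes X: "field_along V \<gamma> X" and s: "s \<in> {0..1}"
  shows "derivative_on_01 X s (v \<cdot> k) = derivative_on_01 X s v \<cdot> k"
proof -
  note d = bounded_linear.has_vector_derivative[OF blinfun.bounded_linear_left
      field_along_derivative[OF X s]]
  have "((\<lambda>s. X s v \<cdot> k) has_vector_derivative derivative_on_01 X s v \<cdot> k) (at s within {0..1})"
    by (rule bounded_linear.has_vector_derivative[OF
          bounded_bilinear.bounded_linear_left[OF bounded_bilinear_smul] d])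
  then have "((\<lambda>s. X s (v \<cdot> k)) has_vector_derivative derivative_on_01 X s v \<cdot> k) (at s within {0..1})"
    by (rule has_vector_derivative_transform[OF s, rotated])
      (simp add: tangent_klinear[OF field_along_tangent[OF X]])
  from derivative_on_01_eqI[OF this s] derivative_on_01_eqI[OF d s] show ?thesis by metis
qed

text \<open>The equation of parallel transport for the value \<open>w = X(g)\<close> on another lift \<open>g\<close> of the curve. By
  the product rule \<open>X'(g) = w' - X(g')\<close>, and the derivative \<open>X'\<close> is again linear over the scalars,
  so that it does not matter on which lift it is evaluated.\<close>

lemma parallel_along_tvecI:
  assumes g: "smooth_on {0..1} g" and line: "\<And>s. s \<in> {0..1} \<Longrightarrow> line V (g s) = line V (\<gamma> s)"
    and w: "smooth_on {0..1} w" and gw: "\<And>s. s \<in> {0..1} \<Longrightarrow> \<langle>g s, w s\<rangle> = 0"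
    and eq: "\<And>s. s \<in> {0..1} \<Longrightarrow> proj V (g s) (derivative_on_01 w s)
      = (1 / qf (g s)) *\<^sub>R (w s \<cdot> \<langle>g s, derivative_on_01 g s\<rangle>)"
  shows "parallel_along V nabla \<gamma> (\<lambda>s. tvec (g s) (w s))" (is "parallel_along V nabla \<gamma> ?X")
proof -
  have qg: "qf (g s) \<noteq> 0" and \<gamma>g: "\<exists>c. c \<noteq> 0 \<and> \<gamma> s = g s \<cdot> c" if s: "s \<in> {0..1}" for s
  proof -
    show "\<exists>c. c \<noteq> 0 \<and> \<gamma> s = g s \<cdot> c"
      using line_eqE[OF line[OF s] qf_nonzero_imp[OF nonisotropic_curve[OF s]]] by metis
    then show "qf (g s) \<noteq> 0"
      using nonisotropic_curve[OF s] by (auto simp: qf_smul)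
  qed
  have X: "field_along V \<gamma> ?X"
    unfolding field_along_def
    using smooth_on_tvec[OF g w qg] tvec_tangent[OF qg] line by (metis (no_types, lifting))
  have "covD ?X s = 0" if s: "s \<in> {0..1}" for s
  proof -
    obtain c where c: "c \<noteq> 0" "\<gamma> s = g s \<cdot> c" using \<gamma>g[OF s] by blast
    let ?y = "derivative_on_01 g s"
    note dg = smooth_on_01_has_vector_derivative[OF g s]
    note d = bounded_bilinear.has_vector_derivative[OF bounded_bilinear_blinfun_apply
        field_along_derivative[OF X s] dg]
    have "(w has_vector_derivative ?X s ?y + derivative_on_01 ?X s (g s)) (at s within {0..1})"
      by (rule has_vector_derivative_transform[OF s _ d]) (simp add: qg gw)
    from derivative_on_01_eqI[OF this s]
    have "derivative_on_01 w s = ?X s ?y + derivative_on_01 ?X s (g s)" .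
    moreover have "\<langle>g s, ?X s ?y\<rangle> = 0"
      using gw[OF s] by (simp add: tvec_apply herm_scaleR_right herm_smul_right)
    ultimately have "proj V (g s) (derivative_on_01 ?X s (g s))
        = proj V (g s) (derivative_on_01 w s) - ?X s ?y"
      by (simp add: proj_add)
    also have "\<dots> = 0"
      using gw[OF s] by (simp add: eq[OF s] tvec_apply)
    finally have "tvec (g s) (derivative_on_01 ?X s (g s)) = 0"
      by (rule tvec_eq_0)
    then show ?thesis
      by (simp add: covD_def c(2) derivative_klinear[OF X s] tvec_smul[OF c(1)])
  qed
  with X show ?thesis by (simp add: parallel_along_iff)
qed

text \<open>The solution along the lift \<open>x = p + \<tau> e\<close>. With \<open>N = 1 + \<mu> \<tau>\<^sup>2\<close> one has
  \<open>\<langle>x, x\<rangle> = N \<langle>p, p\<rangle>\<close>. A constant vector orthogonal to \<open>p\<close> and \<open>e\<close> only has to be rescaled by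
  \<open>\<surd>N\<close>; in the line, the vector \<open>e - \<mu> \<tau> p\<close> orthogonal to \<open>x\<close> has a derivative whose
  component orthogonal to \<open>x\<close> is the required multiple \<open>\<mu> \<tau> \<tau>' / N\<close> of itself.\<close>

lemma parallel_along_segment:
  assumes p: "qf p \<noteq> 0" and pe: "\<langle>p, e\<rangle> = 0" and pu: "\<langle>p, u\<rangle> = 0" and eu: "\<langle>e, u\<rangle> = 0"
    and \<tau>: "smooth_on {0..1} \<tau>"
    and line: "\<And>s. s \<in> {0..1} \<Longrightarrow> line V (p + \<tau> s *\<^sub>R e) = line V (\<gamma> s)"
    and \<mu>: "\<mu> = qf e / qf p" and pos: "\<And>s. s \<in> {0..1} \<Longrightarrow> 1 + \<mu> * (\<tau> s)\<^sup>2 > 0"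
  shows "parallel_along V nabla \<gamma> (\<lambda>s. tvec (p + \<tau> s *\<^sub>R e)
    ((e - (\<mu> * \<tau> s) *\<^sub>R p) \<cdot> k + sqrt (1 + \<mu> * (\<tau> s)\<^sup>2) *\<^sub>R u))"
proof (rule parallel_along_tvecI)
  let ?N = "\<lambda>s. 1 + \<mu> * (\<tau> s)\<^sup>2"
  have qe: "qf e = \<mu> * qf p" using p by (simp add: \<mu>)
  have ep: "\<langle>e, p\<rangle> = 0" using pe herm_eq_0_commute by blast
  show g: "smooth_on {0..1} (\<lambda>s. p + \<tau> s *\<^sub>R e)"
    by (intro smooth_on_add smooth_on_scaleR smooth_on_const \<tau>)
  show w: "smooth_on {0..1} (\<lambda>s. (e - (\<mu> * \<tau> s) *\<^sub>R p) \<cdot> k + sqrt (?N s) *\<^sub>R u)"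
    unfolding power2_eq_square
    by (intro smooth_on_add smooth_on_smul smooth_on_diff smooth_on_scaleR smooth_on_mult
        smooth_on_sqrt smooth_on_const \<tau>) (use pos in \<open>simp add: power2_eq_square\<close>)
  fix s :: real
  assume s: "s \<in> {0..1}"
  show "line V (p + \<tau> s *\<^sub>R e) = line V (\<gamma> s)" by (rule line[OF s])
  define x y n where "x = p + \<tau> s *\<^sub>R e" and "y = (e - (\<mu> * \<tau> s) *\<^sub>R p) \<cdot> k" and "n = ?N s"
  have n: "n > 0" using pos[OF s] by (simp add: n_def)
  have qx: "qf x = qf p * n"
    by (simp add: x_def n_def qf_add_orthogonal[OF pe] qe algebra_simps)
  have nz: "qf x \<noteq> 0"
    using p n by (simp add: qx)
  have xu: "\<langle>x, u\<rangle> = 0"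
    by (simp add: x_def herm_add_left herm_scaleR_left pu eu)
  have xy: "\<langle>x, y\<rangle> = 0"
    by (simp add: x_def y_def herm_smul_right herm_add_left herm_diff_right herm_scaleR_left
        herm_scaleR_right pe ep herm_self qe) (simp add: of_real_def)
  show "\<langle>p + \<tau> s *\<^sub>R e, (e - (\<mu> * \<tau> s) *\<^sub>R p) \<cdot> k + sqrt (?N s) *\<^sub>R u\<rangle> = 0"
    using xu xy by (simp add: x_def y_def herm_add_right herm_scaleR_right)
  define d where "d = derivative_on_01 \<tau> s"
  define a where "a = \<mu> * \<tau> s * d / n"
  have d: "(\<tau> has_real_derivative d) (at s within {0..1})"
    using smooth_on_01_has_vector_derivative[OF \<tau> s]
    by (simp add: d_def has_real_derivative_iff_has_vector_derivative)
  have "((\<lambda>s. sqrt (?N s)) has_real_derivative (\<mu> * \<tau> s * d) / sqrt n) (at s within {0..1})"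
    using n unfolding n_def by (auto intro!: derivative_eq_intros d simp: field_simps)
  moreover have "(\<mu> * \<tau> s * d) / sqrt n = a * sqrt n"
    using n by (simp add: a_def field_simps)
  ultimately have dN: "((\<lambda>s. sqrt (?N s)) has_real_derivative a * sqrt n) (at s within {0..1})"
    by simp
  have dg: "derivative_on_01 (\<lambda>s. p + \<tau> s *\<^sub>R e) s = d *\<^sub>R e"
    by (rule derivative_on_01_eqI[OF _ s]) (auto intro!: derivative_eq_intros d)
  have "((\<lambda>s. e - (\<mu> * \<tau> s) *\<^sub>R p) has_vector_derivative - ((\<mu> * d) *\<^sub>R p)) (at s within {0..1})"
    by (auto intro!: derivative_eq_intros d)
  note dy = bounded_linear.has_vector_derivative[OF bounded_bilinear.bounded_linear_left[OF
        bounded_bilinear_smul, of k] this]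
  have du: "((\<lambda>s. sqrt (?N s) *\<^sub>R u) has_vector_derivative (a * sqrt n) *\<^sub>R u) (at s within {0..1})"
    using has_vector_derivative_scaleR[OF dN has_vector_derivative_const[of u]] by simp
  have dw: "derivative_on_01 (\<lambda>s. (e - (\<mu> * \<tau> s) *\<^sub>R p) \<cdot> k + sqrt (?N s) *\<^sub>R u) s
      = - ((\<mu> * d) *\<^sub>R p) \<cdot> k + (a * sqrt n) *\<^sub>R u"
    by (rule derivative_on_01_eqI[OF has_vector_derivative_add[OF dy du] s])
  \<comment> \<open>The derivative of \<open>e - \<mu> \<tau> p\<close>, split into its components orthogonal to and along \<open>x\<close>,
    is cleared of the denominator \<open>n\<close>.\<close>
  have "n *\<^sub>R (a *\<^sub>R (e - (\<mu> * \<tau> s) *\<^sub>R p) - (\<mu> * d / n) *\<^sub>R x) = n *\<^sub>R (- ((\<mu> * d) *\<^sub>R p))"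
  proof -
    have "n * a = \<mu> * \<tau> s * d" "n * (\<mu> * d / n) = \<mu> * d"
      using n by (simp_all add: a_def)
    then have "n *\<^sub>R (a *\<^sub>R (e - (\<mu> * \<tau> s) *\<^sub>R p) - (\<mu> * d / n) *\<^sub>R x)
        = (\<mu> * \<tau> s * d) *\<^sub>R (e - (\<mu> * \<tau> s) *\<^sub>R p) - (\<mu> * d) *\<^sub>R x"
      by (subst scaleR_diff_right) (simp only: scaleR_scaleR)
    also have "\<dots> = n *\<^sub>R (- ((\<mu> * d) *\<^sub>R p))"
      by (simp add: x_def n_def algebra_simps power2_eq_square)
    finally show ?thesis .
  qed
  then have "- ((\<mu> * d) *\<^sub>R p) = a *\<^sub>R (e - (\<mu> * \<tau> s) *\<^sub>R p) - (\<mu> * d / n) *\<^sub>R x"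
    using n by (simp only: scaleR_cancel_left) simp
  then have "- ((\<mu> * d) *\<^sub>R p) \<cdot> k = a *\<^sub>R y - x \<cdot> ((\<mu> * d / n) *\<^sub>R k)"
    by (simp only: y_def smul_diff_left smul_scaleR_left smul_scaleR_right)
  then have "proj V x (- ((\<mu> * d) *\<^sub>R p) \<cdot> k + (a * sqrt n) *\<^sub>R u) = a *\<^sub>R (y + sqrt n *\<^sub>R u)"
    using xy xu
    by (simp only: proj_add proj_diff proj_scaleR proj_self[OF nz] proj_orthogonal) (simp add: algebra_simps)
  also have "\<dots> = (1 / qf x) *\<^sub>R ((y + sqrt n *\<^sub>R u) \<cdot> \<langle>x, d *\<^sub>R e\<rangle>)"
  proof -
    have "\<langle>x, d *\<^sub>R e\<rangle> = of_real (\<mu> * \<tau> s * d * qf p)"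
      by (simp add: x_def herm_add_left herm_scaleR_left herm_scaleR_right pe herm_self qe)
        (simp add: of_real_def)
    moreover have "(1 / qf x) * (\<mu> * \<tau> s * d * qf p) = a"
      using p n by (simp add: qx a_def)
    ultimately show ?thesis by (simp only: smul_of_real scaleR_scaleR)
  qed
  finally show "proj V (p + \<tau> s *\<^sub>R e)
      (derivative_on_01 (\<lambda>s. (e - (\<mu> * \<tau> s) *\<^sub>R p) \<cdot> k + sqrt (?N s) *\<^sub>R u) s)
    = (1 / qf (p + \<tau> s *\<^sub>R e)) *\<^sub>R (((e - (\<mu> * \<tau> s) *\<^sub>R p) \<cdot> k + sqrt (?N s) *\<^sub>R u)
        \<cdot> \<langle>p + \<tau> s *\<^sub>R e, derivative_on_01 (\<lambda>s. p + \<tau> s *\<^sub>R e) s\<rangle>)"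
    unfolding dg dw x_def[symmetric] y_def[symmetric] n_def[symmetric] .
qed

end

theorem corollary5p7:
  fixes V :: "('k::rch, 'v::euclidean_space) hspace"
    and \<sigma> :: real
    and nabla :: "'v set \<Rightarrow> ('v \<Rightarrow>\<^sub>L 'v) \<Rightarrow> ('v set \<Rightarrow> ('v \<Rightarrow>\<^sub>L 'v)) \<Rightarrow> ('v \<Rightarrow>\<^sub>L 'v)"
    and p q :: 'v and L :: "'v set" and t h v :: "'v \<Rightarrow>\<^sub>L 'v" and \<gamma> :: "real \<Rightarrow> 'v"
  assumes "hermitian_space V"
    and "\<sigma> \<in> {1, -1}"
    and "levi_civita V \<sigma> nabla"
    and "nonisotropic V p" and "nonisotropic V q"
    and "line V p \<noteq> line V q"
    and "\<langle>p,q\<rangle>\<^bsub>V\<^esub> \<noteq> 0"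
    and "sgn (re \<langle>p,p\<rangle>\<^bsub>V\<^esub>) = sgn (re \<langle>q,q\<rangle>\<^bsub>V\<^esub>)"
    and "L = span2 V p q" and "\<not> euclidean V L"
    and "t \<in> tangent_space V (line V p)" and "t = h + v"
    and "h \<in> tangent_to_line V L (line V p)"
    and "v \<in> normal_to_line V \<sigma> L (line V p)"
    and "parametrizes_segment V p q \<gamma>"
  shows "parallel_transport V nabla \<gamma> t = Tn V p h q + Ct V p v q"
proof -
  interpret hermitian_space V by fact
  interpret levi_civita V \<sigma> nabla by fact
  interpret hermitian_levi_civita V \<sigma> nabla
    by unfold_locales (use assms(2) in auto)
  have p: "qf p \<noteq> 0" and q: "qf q \<noteq> 0"
    using assms(4,5) by (simp_all add: nonisotropic_iff)
  have sgn: "sgn (qf p) = sgn (qf q)"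
    using assms(8) by (simp add: qf_def)
  obtain e \<tau> c where pe: "\<langle>p, e\<rangle>\<^bsub>V\<^esub> = 0" and c: "c \<noteq> 0" "p + e = q \<cdot>\<^bsub>V\<^esub> c"
    and \<tau>: "smooth_on {0..1} \<tau>" "\<tau> 0 = 0" "\<tau> 1 = 1"
    and line: "\<And>s. s \<in> {0..1} \<Longrightarrow> line V (p + \<tau> s *\<^sub>R e) = line V (\<gamma> s)"
    and pos: "\<And>s. s \<in> {0..1} \<Longrightarrow> 1 + qf e / qf p * (\<tau> s)\<^sup>2 > 0"
    by (rule segment_lift[OF assms(15) p q sgn assms(6)]) (rule that)
  define \<mu> where "\<mu> = qf e / qf p"
  define N where "N = 1 + \<mu>"
  note pos = pos[folded \<mu>_def]
  have qx: "qf (p + r *\<^sub>R e) = qf p * (1 + \<mu> * r\<^sup>2)" for r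
    using p by (simp add: qf_add_orthogonal[OF pe] \<mu>_def field_simps)
  interpret nonisotropic_curve V \<sigma> nabla \<gamma>
  proof
    show "smooth_on {0..1} \<gamma>"
      using assms(15) by (simp add: parametrizes_segment_def)
    fix s :: real
    assume s: "s \<in> {0..1}"
    have q0: "qf (p + \<tau> s *\<^sub>R e) \<noteq> 0"
      unfolding qx using p pos[OF s] by simp
    have "\<gamma> s \<noteq> 0"
      using assms(15) s by (simp add: parametrizes_segment_def)
    then obtain k where "k \<noteq> 0" "\<gamma> s = (p + \<tau> s *\<^sub>R e) \<cdot>\<^bsub>V\<^esub> k"
      using line_eqE[OF line[OF s]] by blast
    with q0 show "qf (\<gamma> s) \<noteq> 0"
      by (simp add: qf_smul)
  qed
  have ht: "h \<in> tangent_space V (line V p)" and vt: "v \<in> tangent_space V (line V p)"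
    using assms(13,14) by (auto simp: tangent_to_line_def normal_to_line_def)
  obtain k where k: "h p = e \<cdot>\<^bsub>V\<^esub> k"
    using horizontal_value[OF assms(13)[unfolded assms(9)] p pe c] .
  have ev: "\<langle>e, v p\<rangle>\<^bsub>V\<^esub> = 0"
    by (rule vertical_value[OF assms(14)[unfolded assms(9)] sign p pe c(2)])
  define X where "X s = tvec (p + \<tau> s *\<^sub>R e)
    ((e - (\<mu> * \<tau> s) *\<^sub>R p) \<cdot>\<^bsub>V\<^esub> k + sqrt (1 + \<mu> * (\<tau> s)\<^sup>2) *\<^sub>R v p)" for s
  have par: "parallel_along V nabla \<gamma> X"
    unfolding X_def[abs_def]
    by (rule parallel_along_segment[OF p pe tangent_herm[OF vt] ev \<tau>(1) line \<mu>_def pos])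
  have "X 0 = tvec p (t p)"
    by (simp add: X_def \<tau>(2) k[symmetric] assms(12) blinfun.add_left)
  also have "\<dots> = t"
    using tangent_eq_tvec[OF assms(11) p] by simp
  finally have X0: "X 0 = t" .
  have N: "N > 0" using pos[of 1] by (simp add: N_def \<tau>(3))
  have q1: "qf (p + e) = qf p * N"
    using qx[of 1] by (simp add: N_def)
  have "ta V p q = ta V p (p + e)"
    by (simp add: c ta_smul)
  also have "\<dots> = 1 / N"
    using p N by (simp add: ta_eq q1 herm_add_right pe herm_self power2_eq_square)
  finally have ta: "ta V p q = 1 / N" .
  have spread: "spread V w q = tvec (p + e) (w p)" if w: "w \<in> tangent_space V (line V p)" for w
  proof -
    have kl: "klinear V w" using w by (simp add: tangent_space_def)
    have "spread V w q = tvec (p + e) (w (p + e))"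
      using spread_smul[OF kl c(1), of q] spread_eq_tvec[OF kl] c(2) by simp
    then show ?thesis
      using tangent_kernel[OF w pe] by (simp add: blinfun.add_right)
  qed
  have "X 1 = tvec (p + e) ((e - \<mu> *\<^sub>R p) \<cdot>\<^bsub>V\<^esub> k + sqrt N *\<^sub>R v p)"
    by (simp add: X_def \<tau>(3) N_def)
  \<comment> \<open>At the end point, \<open>e - \<mu> p\<close> and \<open>N e\<close> differ by a multiple of \<open>p + e\<close>, which the projection
    in \<open>tvec\<close> removes. The factors \<open>N\<close> and \<open>\<surd>N\<close> are those of \<open>Tn\<close> and \<open>Ct\<close>.\<close>
  also have "(e - \<mu> *\<^sub>R p) \<cdot>\<^bsub>V\<^esub> k = N *\<^sub>R h p + (p + e) \<cdot>\<^bsub>V\<^esub> (- \<mu> *\<^sub>R k)"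
  proof -
    have "e - \<mu> *\<^sub>R p = N *\<^sub>R e + (- \<mu>) *\<^sub>R (p + e)"
      by (simp add: N_def algebra_simps)
    then show ?thesis
      by (simp only: k smul_add_left smul_scaleR_left smul_scaleR_right)
  qed
  also have "tvec (p + e) (N *\<^sub>R h p + (p + e) \<cdot>\<^bsub>V\<^esub> (- \<mu> *\<^sub>R k) + sqrt N *\<^sub>R v p)
      = N *\<^sub>R tvec (p + e) (h p) + sqrt N *\<^sub>R tvec (p + e) (v p)"
    using p N by (simp only: tvec_add tvec_scaleR tvec_add_fibre q1) (simp add: tvec_eq_0 proj_self q1)
  also have "\<dots> = Tn V p h q + Ct V p v q"
    by (simp add: Tn_def Ct_def ta spread[OF ht] spread[OF vt] real_sqrt_divide)
  finally show ?thesis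
    using parallel_transport_eq[OF par] X0 by simp
qed

end
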